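(* Consider the one-bit-feedback opportunistic interference alignment scheme described in the context with $d=1$, so that $N_R=2$ and the channel matrices are $2\times 1$. Let $d'\in[0,1]$. Suppose the number of users per cell is scaled as $K\propto P^{d'}$, that is, $K=K(P)\ge 2$ is an integer with $K(P)/P^{d'}\to\kappa$ for some constant $\kappa\in(0,\infty)$ as $P\to\infty$. Suppose further that the threshold is chosen as $$\hat{x}=1-\Big(\frac{1}{K}\Big)^{\frac{1}{K-1}}.$$ Then each transmitter $i$ achieves DoF $d'$, that is, $$\liminf_{P\to\infty}\frac{\mathbb{E}[R_i^{k^\dagger}]}{\log_2 P}\ge d'.$$
   Context: System model. Fix an integer $d\ge 1$ and set $N_R=2d$. There are three cells $i\in\{1,2,3\}$; transmitter $i$ serves $K$ users $k\in\{1,\dots,K\}$ in cell $i$. The effective channel from transmitter $j$ to user $k$ in cell $i$ is $\mathbf{H}_{i,j}^k\in\mathbb{C}^{N_R\times d}$. All entries of all these matrices are i.i.d. circularly symmetric complex Gaussian with zero mean and unit variance. Transmitter $j$ sends $\mathbf{s}_j\in\mathbb{C}^d$ with $\mathbb{E}[\mathbf{s}_j\mathbf{s}_j^H]=\frac{P}{d}\mathbf{I}_d$. The noise is $\mathcal{CN}(0,\mathbf{I}_{N_R})$, and the SNR equals $P$. For cell $i$, let $p=(i+1 \bmod 3)$ and $q=(i+2\bmod 3)$ index the two other (interfering) transmitters. Metric. For matrices $\mathbf{A},\mathbf{B}\in\mathbb{C}^{N_R\times d}$ with orthonormal columns, the chordal distance is $d_c(\mathbf{A},\mathbf{B})=\frac{1}{\sqrt2}\|\mathbf{A}\mathbf{A}^H-\mathbf{B}\mathbf{B}^H\|_F$.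 User $k$ in cell $i$ computes orthonormal bases $\mathbf{Q}_{ip}^k,\mathbf{Q}_{iq}^k$ of the column spaces of $\mathbf{H}_{i,p}^k$ and $\mathbf{H}_{i,q}^k$, and the metric $\mathcal{D}_i^k=d_c^2(\mathbf{Q}_{ip}^k,\mathbf{Q}_{iq}^k)$. One-bit scheme with threshold $x$. Each user reports bit 1 if $\mathcal{D}_i^k<x$ and bit 0 otherwise. Transmitter $i$ selects a user $k^\dagger$ uniformly at random among those reporting 1. If all users report 0 (scheduling outage), it selects $k^\dagger$ uniformly at random among all $K$ users. Receiver and rate. With $\mathbf{R}_i^k=\mathbf{H}_{i,p}^k{\mathbf{H}_{i,p}^k}^H+\mathbf{H}_{i,q}^k{\mathbf{H}_{i,q}^k}^H$, the postfilter $\mathbf{U}_i^k\in\mathbb{C}^{N_R\times d}$ consists of the singular vectors of $\mathbf{R}_i^k$ associated with its $d+1,\dots,N_R$-th largest singular values. The rate of user $k$ is $$R_i^k=\log_2\det\Big(\mathbf{I}_d+\tfrac{P}{d}{\mathbf{U}_i^k}^H\mathbf{H}_{i,i}^k{\mathbf{H}_{i,i}^k}^H\mathbf{U}_i^k\Big(\mathbf{I}_d+\tfrac{P}{d}\sum_{j\ne i}{\mathbf{U}_i^k}^H\mathbf{H}_{i,j}^k{\mathbf{H}_{i,j}^k}^H\mathbf{U}_i^k\Big)^{-1}\Big).$$ The DoF achieved at transmitter $i$ is $\lim_{P\to\infty}\mathbb{E}[R_i^{k^\dagger}]/\log_2P$. The expectation is over the channels and the random selection. *)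

theory Defs
  imports "HOL-Probability.Probability"
begin

definition cgauss :: "complex measure" where
  "cgauss = distr
     (density (lborel \<Otimes>\<^sub>M lborel)
        (\<lambda>(a,b). ennreal (normal_density 0 (sqrt (1/2)) a * normal_density 0 (sqrt (1/2)) b)))
     borel (\<lambda>(a,b). Complex a b)"

text \<open>Vectors in C^2 are functions nat => complex on indices 0,1; 2x2 matrices are
  functions nat => nat => complex on indices 0,1.\<close>
type_synonym cvec = "nat \<Rightarrow> complex"
type_synonym cmat = "nat \<Rightarrow> nat \<Rightarrow> complex"

definition vnorm :: "cvec \<Rightarrow> real" where
  "vnorm u = sqrt (\<Sum>r<2. (cmod (u r))\<^sup>2)"

definition cinner :: "cvec \<Rightarrow> cvec \<Rightarrow> complex" where
  "cinner u v = (\<Sum>r<2. cnj (u r) * v r)"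

text \<open>Orthonormal basis of the column space of a 2x1 matrix h (i.e. h normalised).\<close>
definition orth_basis :: "cvec \<Rightarrow> cvec" where
  "orth_basis h = (\<lambda>r. h r / complex_of_real (vnorm h))"

definition chordal_dist_sq :: "cvec \<Rightarrow> cvec \<Rightarrow> real" where
  "chordal_dist_sq a b =
     (1/2) * (\<Sum>r<2. \<Sum>c<2. (cmod (a r * cnj (a c) - b r * cnj (b c)))\<^sup>2)"

definition mat_vec :: "cmat \<Rightarrow> cvec \<Rightarrow> cvec" where
  "mat_vec M v = (\<lambda>r. \<Sum>c<2. M r c * v c)"

definition conj_transpose :: "cmat \<Rightarrow> cmat" where
  "conj_transpose M = (\<lambda>r c. cnj (M c r))"

definition sing_triple :: "cmat \<Rightarrow> real \<Rightarrow> cvec \<Rightarrow> cvec \<Rightarrow> bool" where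
  "sing_triple M \<sigma> u v \<longleftrightarrow> \<sigma> \<ge> 0 \<and> vnorm u = 1 \<and> vnorm v = 1 \<and>
     (\<forall>r<2. mat_vec M v r = complex_of_real \<sigma> * u r) \<and>
     (\<forall>r<2. mat_vec (conj_transpose M) u r = complex_of_real \<sigma> * v r)"

text \<open>For a 2x2 matrix the 2nd largest singular value is the smallest one.\<close>
definition second_sing_val :: "cmat \<Rightarrow> real" where
  "second_sing_val M = Inf {\<sigma>. \<exists>u v. sing_triple M \<sigma> u v}"

text \<open>Postfilter: (left) singular vector of M associated with its
  d+1 .. N_R = 2nd largest singular value.\<close>
definition postfilter :: "cmat \<Rightarrow> cvec" where
  "postfilter M = (SOME u. \<exists>v. sing_triple M (second_sing_val M) u v)"

text \<open>Channel realisation: \<omega> (i,j,k,r) is entry r of H_{i,j}^k (cells and transmitters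
  indexed 0,1,2; users 0..K-1).\<close>
definition chan_idx :: "nat \<Rightarrow> (nat \<times> nat \<times> nat \<times> nat) set" where
  "chan_idx K = {..<3} \<times> {..<3} \<times> {..<K} \<times> {..<2}"

definition chan_space :: "nat \<Rightarrow> ((nat \<times> nat \<times> nat \<times> nat) \<Rightarrow> complex) measure" where
  "chan_space K = PiM (chan_idx K) (\<lambda>_. cgauss)"

definition chan :: "((nat \<times> nat \<times> nat \<times> nat) \<Rightarrow> complex) \<Rightarrow> nat \<Rightarrow> nat \<Rightarrow> nat \<Rightarrow> cvec" where
  "chan \<omega> i j k = (\<lambda>r. \<omega> (i, j, k, r))"

definition interf1 :: "nat \<Rightarrow> nat" where "interf1 i = (i + 1) mod 3"
definition interf2 :: "nat \<Rightarrow> nat" where "interf2 i = (i + 2) mod 3"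

definition metric_D :: "((nat \<times> nat \<times> nat \<times> nat) \<Rightarrow> complex) \<Rightarrow> nat \<Rightarrow> nat \<Rightarrow> real" where
  "metric_D \<omega> i k = chordal_dist_sq (orth_basis (chan \<omega> i (interf1 i) k))
                                     (orth_basis (chan \<omega> i (interf2 i) k))"

definition interf_cov :: "((nat \<times> nat \<times> nat \<times> nat) \<Rightarrow> complex) \<Rightarrow> nat \<Rightarrow> nat \<Rightarrow> cmat" where
  "interf_cov \<omega> i k = (\<lambda>r c.
     chan \<omega> i (interf1 i) k r * cnj (chan \<omega> i (interf1 i) k c) +
     chan \<omega> i (interf2 i) k r * cnj (chan \<omega> i (interf2 i) k c))"

text \<open>Rate R_i^k for d = 1 (all matrices in the determinant are 1x1).\<close>
definition rate :: "real \<Rightarrow> ((nat \<times> nat \<times> nat \<times> nat) \<Rightarrow> complex) \<Rightarrow> nat \<Rightarrow> nat \<Rightarrow> real" where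
  "rate P \<omega> i k =
     (let u = postfilter (interf_cov \<omega> i k);
          S = P * (cmod (cinner u (chan \<omega> i i k)))\<^sup>2;
          I = P * (\<Sum>j\<in>{..<3} - {i}. (cmod (cinner u (chan \<omega> i j k)))\<^sup>2)
      in log 2 (1 + S / (1 + I)))"

definition reporters :: "nat \<Rightarrow> real \<Rightarrow> ((nat \<times> nat \<times> nat \<times> nat) \<Rightarrow> complex) \<Rightarrow> nat \<Rightarrow> nat set" where
  "reporters K x \<omega> i = {k. k < K \<and> metric_D \<omega> i k < x}"

text \<open>Rate of the selected user, averaged over the uniform random selection.\<close>
definition selected_rate :: "nat \<Rightarrow> real \<Rightarrow> real \<Rightarrow> ((nat \<times> nat \<times> nat \<times> nat) \<Rightarrow> complex) \<Rightarrow> nat \<Rightarrow> real" where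
  "selected_rate K x P \<omega> i =
     (if reporters K x \<omega> i \<noteq> {}
      then (\<Sum>k\<in>reporters K x \<omega> i. rate P \<omega> i k) / real (card (reporters K x \<omega> i))
      else (\<Sum>k<K. rate P \<omega> i k) / real K)"

text \<open>E[R_i^{k dagger}] (the integrand is nonnegative).\<close>
definition expected_rate :: "nat \<Rightarrow> real \<Rightarrow> real \<Rightarrow> nat \<Rightarrow> real" where
  "expected_rate K x P i =
     enn2real (\<integral>\<^sup>+ \<omega>. ennreal (selected_rate K x P \<omega> i) \<partial>chan_space K)"

definition threshold :: "nat \<Rightarrow> real" where
  "threshold K = 1 - (1 / real K) powr (1 / (real K - 1))"

end

theory Submission
  imports Defs "HOL-Real_Asymp.Real_Asymp"
begin

text \<open>
  Write a, b, h for the two interfering channels and the desired channel of a user. The postfilter u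
  is a unit eigenvector of the smallest eigenvalue of a a* + b b*, so the residual interference is
  that eigenvalue, which the determinant bounds by D |b|^2, where D is the reported metric. The
  metric is roughly uniform near 0: P(D < x) lies between two constant multiples of x. For the
  threshold x, of order ln K / K, an outage has probability at most exp (- c K x), which tends to 0.
  With l = ln P, call a reporting user bad if |b|^2 > l^2 or |u* h|^2 < 1 / l^2. Conditioning on
  all channel entries but one shows that a given user reports and is bad with probability
  O(x / l^2), so by K x = O(l) the union bound excludes bad reporters with high probability. If
  there is no outage and no bad reporter, then every reporting user has rate at least
  log (1 + P l^-2 / (1 + P x l^2)) = d' log P - O(log l).
\<close>

section \<open>The postfilter of a Hermitian matrix\<close>

text \<open>The conditional law of the selected user is never computed: selection averages over the
  reporters, so one event on which all of them are good is enough. The union bound over K users is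
  what shapes the estimates. A weak desired channel alone has probability of order 1 / l^2, far too
  much for K users, so each bad event has to be intersected with reporting and its bound has to keep
  the factor x. The exponent 2 comes from here: K x = O(l) times l^-2 leaves O(1 / l). Factors
  polylogarithmic in P cost only O(log l) in the rate, so crude constants are harmless. The exact
  law of D is therefore replaced by squares inscribed in or circumscribed about discs in the plane
  of a single coefficient. A further obstacle is that \<open>expected_rate\<close> sends an infinite
  integral to 0, so a lower bound on the integral says something only after the integral is shown
  finite. At d' = 0 the number of users stays bounded and the outage bound does not vanish, but
  there the claim reduces to nonnegativity of the rate.\<close>

declare One_nat_def [simp del]

definition vdet :: "cvec \<Rightarrow> cvec \<Rightarrow> complex" where
  "vdet a b = a 0 * b 1 - a 1 * b 0"

lemma sum_lessThan_2: "(\<Sum>r<2. f r) = f 0 + f (1::nat)" for f :: "nat \<Rightarrow> 'a::comm_monoid_add"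
  by (simp add: numeral_2_eq_2 One_nat_def)

lemma less_2_iff: "r < 2 \<longleftrightarrow> r = 0 \<or> r = (1::nat)"
  by auto

lemma mult_cnj_eq: "z * cnj z = of_real ((cmod z)\<^sup>2)"
  by (rule complex_norm_square[symmetric])

lemma vnorm_sq: "(vnorm a)\<^sup>2 = (cmod (a 0))\<^sup>2 + (cmod (a 1))\<^sup>2"
  by (simp add: vnorm_def sum_lessThan_2)

lemma vnorm_eq_1_iff: "vnorm a = 1 \<longleftrightarrow> (cmod (a 0))\<^sup>2 + (cmod (a 1))\<^sup>2 = 1"
  by (simp add: vnorm_def sum_lessThan_2)

lemma vnorm_nonneg: "vnorm a \<ge> 0"
  by (simp add: vnorm_def sum_nonneg)

lemma lagrange_identity:
  "(cmod (cinner a b))\<^sup>2 + (cmod (vdet a b))\<^sup>2 = (vnorm a)\<^sup>2 * (vnorm b)\<^sup>2"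
  by (simp add: vnorm_sq cinner_def vdet_def sum_lessThan_2 cmod_power2) algebra

lemma cinner_sq_le: "(cmod (cinner a b))\<^sup>2 \<le> (vnorm a)\<^sup>2 * (vnorm b)\<^sup>2"
  using lagrange_identity[of a b] by (metis le_add_same_cancel1 zero_le_power2)

text \<open>The squared Frobenius norm of a Hermitian matrix is the trace of its square; for the
  difference of the two rank-one matrices this trace is |a|^4 + |b|^4 - 2 |<a, b>|^2.\<close>

lemma chordal_dist_sq_expand:
  "chordal_dist_sq a b = ((vnorm a)\<^sup>2)\<^sup>2 / 2 + ((vnorm b)\<^sup>2)\<^sup>2 / 2 - (cmod (cinner a b))\<^sup>2"
  unfolding chordal_dist_sq_def vnorm_sq cinner_def sum_lessThan_2 cmod_power2
  by (simp add: field_simps) algebra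

lemma chordal_dist_sq_unit:
  assumes "vnorm a = 1" "vnorm b = 1"
  shows "chordal_dist_sq a b = (cmod (vdet a b))\<^sup>2"
  using lagrange_identity[of a b] assms by (simp add: chordal_dist_sq_expand)

lemma vnorm_orth_basis: "vnorm a \<noteq> 0 \<Longrightarrow> vnorm (orth_basis a) = 1"
proof -
  assume "vnorm a \<noteq> 0"
  then have "((cmod (a 0))\<^sup>2 + (cmod (a 1))\<^sup>2) / (vnorm a)\<^sup>2 = 1"
    by (simp flip: vnorm_sq)
  then show ?thesis
    by (simp add: vnorm_eq_1_iff orth_basis_def norm_divide power_divide add_divide_distrib)
qed

text \<open>The metric is the squared sine of the angle between the two directions, and normalising
  divides the determinant by both norms. The product form lets later estimates avoid
  quotients.\<close>

lemma chordal_dist_sq_orth_basis: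
  assumes "vnorm a \<noteq> 0" "vnorm b \<noteq> 0"
  shows "chordal_dist_sq (orth_basis a) (orth_basis b) * ((vnorm a)\<^sup>2 * (vnorm b)\<^sup>2) = (cmod (vdet a b))\<^sup>2"
proof -
  have "vdet (orth_basis a) (orth_basis b) = vdet a b / (of_real (vnorm a) * of_real (vnorm b))"
    using assms by (simp add: vdet_def orth_basis_def field_simps)
  then have "(cmod (vdet (orth_basis a) (orth_basis b)))\<^sup>2 = (cmod (vdet a b))\<^sup>2 / ((vnorm a)\<^sup>2 * (vnorm b)\<^sup>2)"
    by (simp add: norm_divide norm_mult power_divide power_mult_distrib)
  then show ?thesis
    using assms by (simp add: chordal_dist_sq_unit vnorm_orth_basis)
qed

text \<open>Positive semidefinite matrices with their entries as parameters, so that the eigenvalues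
  become explicit functions of \<open>p\<close>, \<open>s\<close> and \<open>q\<close>. Only the
  indices 0 and 1 are constrained, since a \<open>cmat\<close> is a function on all
  naturals.\<close>

definition herm :: "real \<Rightarrow> real \<Rightarrow> complex \<Rightarrow> cmat \<Rightarrow> bool" where
  "herm p s q M \<longleftrightarrow> M 0 0 = of_real p \<and> M 1 1 = of_real s \<and> M 0 1 = q \<and> M 1 0 = cnj q
     \<and> 0 \<le> p \<and> 0 \<le> s \<and> (cmod q)\<^sup>2 \<le> p * s"

text \<open>The square root of the discriminant of the characteristic polynomial, that is, the
  difference of the two eigenvalues.\<close>

definition eig_gap :: "real \<Rightarrow> real \<Rightarrow> complex \<Rightarrow> real" where
  "eig_gap p s q = sqrt ((p - s)\<^sup>2 + 4 * (cmod q)\<^sup>2)"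

definition eig_min :: "real \<Rightarrow> real \<Rightarrow> complex \<Rightarrow> real" where
  "eig_min p s q = (p + s - eig_gap p s q) / 2"

lemma eig_gap_sq: "(eig_gap p s q)\<^sup>2 = (p - s)\<^sup>2 + 4 * (cmod q)\<^sup>2"
  by (simp add: eig_gap_def)

lemma eig_gap_nonneg: "eig_gap p s q \<ge> 0"
  by (simp add: eig_gap_def)

lemma eig_min_le: "eig_min p s q \<le> p" "eig_min p s q \<le> s"
proof -
  have "\<bar>p - s\<bar> \<le> eig_gap p s q"
    unfolding eig_gap_def by (rule real_le_rsqrt) simp
  then show "eig_min p s q \<le> p" "eig_min p s q \<le> s"
    by (auto simp: eig_min_def)
qed

text \<open>The characteristic polynomial vanishes at its root: the shifted matrix has determinant
  0, which is the equality that \<open>psd_form_nonneg\<close> and \<open>psd_form_zero\<close> take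
  as hypothesis.\<close>

lemma eig_min_char: "(p - eig_min p s q) * (s - eig_min p s q) = (cmod q)\<^sup>2"
proof -
  have "(p - eig_min p s q) * (s - eig_min p s q) = ((eig_gap p s q)\<^sup>2 - (p - s)\<^sup>2) / 4"
    by (simp add: eig_min_def field_simps power2_eq_square)
  then show ?thesis by (simp add: eig_gap_sq)
qed

lemma eig_gap_eq: "eig_gap p s q = (p - eig_min p s q) + (s - eig_min p s q)"
  by (simp add: eig_min_def)

lemma eig_min_nonneg:
  assumes "herm p s q M" shows "0 \<le> eig_min p s q"
proof -
  have "eig_gap p s q \<le> p + s"
    unfolding eig_gap_def using assms
    by (intro real_le_lsqrt) (auto simp: herm_def power2_eq_square algebra_simps)
  then show ?thesis by (simp add: eig_min_def)
qed

lemma herm_quadratic: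
  assumes "herm p s q M"
  shows "cinner w (mat_vec M w) = of_real (p * (cmod (w 0))\<^sup>2 + s * (cmod (w 1))\<^sup>2 + 2 * Re (cnj (w 0) * q * w 1))"
  using assms unfolding herm_def cinner_def mat_vec_def sum_lessThan_2
  unfolding cmod_power2
  by (auto simp: complex_eq_iff power2_eq_square algebra_simps)

text \<open>As |q| is the product of the square roots of \<alpha> and \<beta>, the form dominates
  the square of sqrt \<alpha> |z| - sqrt \<beta> |w|.\<close>

lemma psd_form_nonneg:
  fixes \<alpha> \<beta> :: real and q z w :: complex
  assumes "0 \<le> \<alpha>" "0 \<le> \<beta>" "(cmod q)\<^sup>2 = \<alpha> * \<beta>"
  shows "0 \<le> \<alpha> * (cmod z)\<^sup>2 + \<beta> * (cmod w)\<^sup>2 + 2 * Re (cnj z * q * w)"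
proof -
  have "\<bar>Re (cnj z * q * w)\<bar> \<le> cmod z * cmod q * cmod w"
    using abs_Re_le_cmod[of "cnj z * q * w"] by (simp add: norm_mult)
  moreover have "cmod q = sqrt \<alpha> * sqrt \<beta>"
    using assms by (metis norm_ge_zero real_sqrt_mult real_sqrt_unique)
  moreover have "0 \<le> (sqrt \<alpha> * cmod z - sqrt \<beta> * cmod w)\<^sup>2" by simp
  moreover have "(sqrt \<alpha> * cmod z - sqrt \<beta> * cmod w)\<^sup>2 =
    \<alpha> * (cmod z)\<^sup>2 + \<beta> * (cmod w)\<^sup>2 - 2 * (cmod z * (sqrt \<alpha> * sqrt \<beta>) * cmod w)"
    using assms by (simp add: power2_diff power_mult_distrib algebra_simps)
  ultimately show ?thesis by (smt (verit, best))
qed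

text \<open>A vector on which a singular semidefinite form vanishes lies in its kernel: the squared
  modulus of each component of the image is \<alpha> or \<beta> times the value of the form.\<close>

lemma psd_form_zero:
  fixes \<alpha> \<beta> :: real and q z w :: complex
  assumes "(cmod q)\<^sup>2 = \<alpha> * \<beta>"
    and "\<alpha> * (cmod z)\<^sup>2 + \<beta> * (cmod w)\<^sup>2 + 2 * Re (cnj z * q * w) = 0"
  shows "of_real \<alpha> * z + q * w = 0" "cnj q * z + of_real \<beta> * w = 0"
proof -
  have "(cmod (of_real \<alpha> * z + q * w))\<^sup>2
      = \<alpha> * (\<alpha> * (cmod z)\<^sup>2 + 2 * Re (cnj z * q * w)) + (cmod q)\<^sup>2 * (cmod w)\<^sup>2"
    by (simp add: cmod_power2) algebra
  also have "\<dots> = \<alpha> * (\<alpha> * (cmod z)\<^sup>2 + \<beta> * (cmod w)\<^sup>2 + 2 * Re (cnj z * q * w))"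
    using assms(1) by (simp add: algebra_simps)
  finally show "of_real \<alpha> * z + q * w = 0" using assms(2) by simp
  have "(cmod (cnj q * z + of_real \<beta> * w))\<^sup>2
      = \<beta> * (\<beta> * (cmod w)\<^sup>2 + 2 * Re (cnj z * q * w)) + (cmod q)\<^sup>2 * (cmod z)\<^sup>2"
    by (simp add: cmod_power2) algebra
  also have "\<dots> = \<beta> * (\<alpha> * (cmod z)\<^sup>2 + \<beta> * (cmod w)\<^sup>2 + 2 * Re (cnj z * q * w))"
    using assms(1) by (simp add: algebra_simps)
  finally show "cnj q * z + of_real \<beta> * w = 0" using assms(2) by simp
qed

lemma eig_min_rayleigh:
  assumes "herm p s q M"
  shows "eig_min p s q * (vnorm w)\<^sup>2 \<le> Re (cinner w (mat_vec M w))"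
proof -
  have "0 \<le> (p - eig_min p s q) * (cmod (w 0))\<^sup>2 + (s - eig_min p s q) * (cmod (w 1))\<^sup>2
      + 2 * Re (cnj (w 0) * q * w 1)"
    by (rule psd_form_nonneg) (auto simp: eig_min_le eig_min_char)
  then show ?thesis
    using assms by (simp add: herm_quadratic vnorm_sq algebra_simps)
qed

lemma eig_min_vector_exists:
  assumes "herm p s q M"
  shows "\<exists>u. sing_triple M (eig_min p s q) u u"
proof -
  let ?l = "eig_min p s q"
  obtain z w :: complex where zw: "(z, w) \<noteq> (0, 0)"
    "of_real (p - ?l) * z + q * w = 0" "cnj q * z + of_real (s - ?l) * w = 0"
  proof (cases "p - ?l = 0")
    case True
    then have "q = 0" using eig_min_char[of p s q] by simp
    then show thesis using that[of 1 0] True by simp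
  next
    case False
    have "(of_real (p - ?l) :: complex) * of_real (s - ?l) = q * cnj q"
      unfolding mult_cnj_eq by (metis eig_min_char of_real_mult)
    \<comment> \<open>This vector is orthogonal to the first row of the shifted matrix by
      construction, and to the second because the determinant is 0.\<close>
    then show thesis using that[of "- q" "of_real (p - ?l)"] False
      by (simp add: mult.commute)
  qed
  define n where "n = sqrt ((cmod z)\<^sup>2 + (cmod w)\<^sup>2)"
  have "(cmod z)\<^sup>2 + (cmod w)\<^sup>2 > 0"
    using zw(1) by (auto simp: add_pos_nonneg add_nonneg_pos)
  then have n: "n > 0" "n\<^sup>2 = (cmod z)\<^sup>2 + (cmod w)\<^sup>2" by (auto simp: n_def)
  define u :: cvec where "u = (\<lambda>r. (if r = 0 then z else w) / of_real n)"
  have "vnorm u = 1"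
    using n(1) n(2)[symmetric]
    by (simp add: vnorm_eq_1_iff u_def norm_divide power_divide del: sum_power2_eq_zero_iff flip: add_divide_distrib)
  moreover have e: "of_real p * z + q * w = of_real ?l * z" "cnj q * z + of_real s * w = of_real ?l * w"
    using zw(2,3) by (simp_all add: algebra_simps)
  have "mat_vec M u 0 = of_real ?l * u 0 \<and> mat_vec M u 1 = of_real ?l * u 1"
    using assms e n(1) unfolding herm_def mat_vec_def sum_lessThan_2 u_def
    by (simp add: field_simps)
  moreover have "mat_vec (conj_transpose M) u 0 = of_real ?l * u 0 \<and> mat_vec (conj_transpose M) u 1 = of_real ?l * u 1"
    using assms e n(1) unfolding herm_def mat_vec_def conj_transpose_def sum_lessThan_2 u_def
    by (simp add: field_simps)
  ultimately show ?thesis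
    using eig_min_nonneg[OF assms] unfolding sing_triple_def
    by (intro exI[of _ u]) (auto simp: less_2_iff)
qed

lemma cinner_scale:
  assumes "\<forall>r<2. v r = of_real \<sigma> * u r"
  shows "cinner w v = of_real \<sigma> * cinner w u"
  using assms by (simp add: cinner_def sum_lessThan_2 algebra_simps)

lemma cinner_unit_le:
  assumes "vnorm u = 1" "vnorm v = 1" shows "cmod (cinner u v) \<le> 1"
  using cinner_sq_le[of u v] assms by (simp add: power_le_one_iff abs_square_le_1)

text \<open>For any singular triple the Rayleigh bound at \<open>v\<close> gives that the eigenvalue
  is at most \<sigma> Re <v, u>, hence at most \<sigma> for unit vectors. The eigenvector itself,
  taken on both sides, attains it.\<close>

lemma second_sing_val_herm:
  assumes "herm p s q M"
  shows "second_sing_val M = eig_min p s q"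
  unfolding second_sing_val_def
proof (rule cInf_eq_minimum)
  show "eig_min p s q \<in> {\<sigma>. \<exists>u v. sing_triple M \<sigma> u v}"
    using eig_min_vector_exists[OF assms] by blast
next
  fix \<sigma> assume "\<sigma> \<in> {\<sigma>. \<exists>u v. sing_triple M \<sigma> u v}"
  then obtain u v where t: "sing_triple M \<sigma> u v" by blast
  then have "eig_min p s q \<le> Re (cinner v (mat_vec M v))"
    using eig_min_rayleigh[OF assms, of v] by (simp add: sing_triple_def)
  also have "cinner v (mat_vec M v) = of_real \<sigma> * cinner v u"
    using t by (intro cinner_scale) (simp add: sing_triple_def)
  also have "Re \<dots> \<le> \<sigma> * cmod (cinner v u)"
    using t by (simp add: sing_triple_def complex_Re_le_cmod mult_left_mono)
  also have "\<dots> \<le> \<sigma> * 1"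
    using t cinner_unit_le by (intro mult_left_mono) (auto simp: sing_triple_def)
  finally show "eig_min p s q \<le> \<sigma>" by simp
qed

text \<open>A unit eigenvector is fixed only up to a phase, but its projection u u* is not ambiguous
  when the eigenvalues differ. The last three claims are the entries of the identity: gap times u u*
  equals the larger eigenvalue times the identity matrix, minus M. For gap 0 both sides vanish, so
  no case distinction arises.\<close>

lemma postfilter_herm:
  assumes "herm p s q M"
  defines "u \<equiv> postfilter M"
  shows "vnorm u = 1"
    and "Re (cinner u (mat_vec M u)) = eig_min p s q"
    and "eig_gap p s q * (cmod (u 0))\<^sup>2 = s - eig_min p s q"
    and "eig_gap p s q * (cmod (u 1))\<^sup>2 = p - eig_min p s q"
    and "of_real (eig_gap p s q) * (u 0 * cnj (u 1)) = - q"
proof -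
  let ?l = "eig_min p s q"
  have "\<exists>u v. sing_triple M (second_sing_val M) u v"
    using eig_min_vector_exists[OF assms(1)] second_sing_val_herm[OF assms(1)] by auto
  then have "\<exists>v. sing_triple M (second_sing_val M) u v"
    unfolding u_def postfilter_def by (rule someI_ex)
  then obtain v where t: "sing_triple M ?l u v"
    using second_sing_val_herm[OF assms(1)] by auto
  then show u: "vnorm u = 1" by (simp add: sing_triple_def)
  \<comment> \<open>Being Hermitian turns the equation for the left singular vector into
    \<open>M\<close> applied to \<open>u\<close>. Its form value is then at most the smallest
    eigenvalue, and Rayleigh gives equality.\<close>
  have "conj_transpose M r c = M r c" if "r < 2" "c < 2" for r c
    using assms(1) that by (auto simp: herm_def conj_transpose_def less_2_iff)
  then have "mat_vec (conj_transpose M) u r = mat_vec M u r" if "r < 2" for r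
    using that by (simp add: mat_vec_def)
  then have "cinner u (mat_vec M u) = of_real ?l * cinner u v"
    using t by (intro cinner_scale) (simp add: sing_triple_def)
  then have "Re (cinner u (mat_vec M u)) \<le> ?l * cmod (cinner u v)"
    using t by (simp add: sing_triple_def complex_Re_le_cmod mult_left_mono)
  also have "\<dots> \<le> ?l * 1"
    using t cinner_unit_le by (intro mult_left_mono) (auto simp: sing_triple_def)
  finally have "Re (cinner u (mat_vec M u)) \<le> ?l" by simp
  moreover have "?l \<le> Re (cinner u (mat_vec M u))"
    using eig_min_rayleigh[OF assms(1), of u] u by simp
  ultimately show ray: "Re (cinner u (mat_vec M u)) = ?l" by simp
  have n1: "(cmod (u 0))\<^sup>2 + (cmod (u 1))\<^sup>2 = 1" using u by (simp add: vnorm_eq_1_iff)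
  have "p * (cmod (u 0))\<^sup>2 + s * (cmod (u 1))\<^sup>2 + 2 * Re (cnj (u 0) * q * u 1) = ?l * ((cmod (u 0))\<^sup>2 + (cmod (u 1))\<^sup>2)"
    using ray n1 unfolding herm_quadratic[OF assms(1)] by simp
  \<comment> \<open>Equality in the Rayleigh bound says that the shifted form vanishes at
    \<open>u\<close>, so \<open>psd_form_zero\<close> puts \<open>u\<close> into the kernel.\<close>
  then have z: "(p - ?l) * (cmod (u 0))\<^sup>2 + (s - ?l) * (cmod (u 1))\<^sup>2 + 2 * Re (cnj (u 0) * q * u 1) = 0"
    by (simp add: algebra_simps)
  define \<alpha> \<beta> where "\<alpha> = p - ?l" and "\<beta> = s - ?l"
  have qq: "(cmod q)\<^sup>2 = \<alpha> * \<beta>" by (simp add: eig_min_char \<alpha>_def \<beta>_def)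
  have 1: "of_real \<alpha> * u 0 = - (q * u 1)" and 2: "of_real \<beta> * u 1 = - (cnj q * u 0)"
    using psd_form_zero[OF qq z[folded \<alpha>_def \<beta>_def]] by (auto simp: eq_neg_iff_add_eq_0 add.commute)
  have N: "u 0 * cnj (u 0) + u 1 * cnj (u 1) = 1"
    using n1 by (simp add: mult_cnj_eq flip: of_real_add del: of_real_power)
  have c2: "of_real \<beta> * cnj (u 1) = - (q * cnj (u 0))"
    using arg_cong[OF 2, of cnj] by simp
  have "of_real (\<alpha> + \<beta>) * (u 0 * cnj (u 1)) = (of_real \<alpha> * u 0) * cnj (u 1) + u 0 * (of_real \<beta> * cnj (u 1))"
    by (simp add: algebra_simps)
  also have "\<dots> = - q * (u 0 * cnj (u 0) + u 1 * cnj (u 1))"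
    unfolding 1 c2 by (simp add: algebra_simps)
  finally show "of_real (eig_gap p s q) * (u 0 * cnj (u 1)) = - q"
    using N by (simp add: eig_gap_eq \<alpha>_def \<beta>_def)
  have "of_real \<alpha> * (u 0 * cnj (u 0)) = of_real \<beta> * (u 1 * cnj (u 1))"
    using 1 c2 by (metis (no_types, opaque_lifting) mult.assoc mult.left_commute mult_minus_left mult_minus_right)
  then have "\<alpha> * (cmod (u 0))\<^sup>2 = \<beta> * (cmod (u 1))\<^sup>2"
    by (simp add: mult_cnj_eq flip: of_real_mult del: of_real_power)
  then show "eig_gap p s q * (cmod (u 0))\<^sup>2 = s - ?l" "eig_gap p s q * (cmod (u 1))\<^sup>2 = p - ?l"
    using n1 unfolding eig_gap_eq \<alpha>_def[symmetric] \<beta>_def[symmetric] by algebra+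
qed

section \<open>Deterministic rate bounds\<close>

definition cov :: "cvec \<Rightarrow> cvec \<Rightarrow> cmat" where
  "cov a b = (\<lambda>r c. a r * cnj (a c) + b r * cnj (b c))"

definition cov_p :: "cvec \<Rightarrow> cvec \<Rightarrow> real" where "cov_p a b = (cmod (a 0))\<^sup>2 + (cmod (b 0))\<^sup>2"
definition cov_s :: "cvec \<Rightarrow> cvec \<Rightarrow> real" where "cov_s a b = (cmod (a 1))\<^sup>2 + (cmod (b 1))\<^sup>2"
definition cov_q :: "cvec \<Rightarrow> cvec \<Rightarrow> complex" where "cov_q a b = a 0 * cnj (a 1) + b 0 * cnj (b 1)"

text \<open>The interference power that survives the postfilter, in closed form; the identification
  is the second claim of \<open>postfilter_cov\<close>.\<close>

definition leak :: "cvec \<Rightarrow> cvec \<Rightarrow> real" where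
  "leak a b = eig_min (cov_p a b) (cov_s a b) (cov_q a b)"

definition gap :: "cvec \<Rightarrow> cvec \<Rightarrow> real" where
  "gap a b = eig_gap (cov_p a b) (cov_s a b) (cov_q a b)"

text \<open>
  The postfilter is chosen by SOME, so its measurability in the channels is unclear. The function
  \<open>gain_gap\<close> equals \<open>gap a b * (cmod (cinner u h))\<^sup>2\<close> for u the postfilter and is explicit in the channels.
\<close>

definition gain_gap :: "cvec \<Rightarrow> cvec \<Rightarrow> cvec \<Rightarrow> real" where
  "gain_gap a b h = (cov_s a b - leak a b) * (cmod (h 0))\<^sup>2 + (cov_p a b - leak a b) * (cmod (h 1))\<^sup>2
     - 2 * Re (cnj (cov_q a b) * h 0 * cnj (h 1))"

definition chord :: "cvec \<Rightarrow> cvec \<Rightarrow> real" where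
  "chord a b = chordal_dist_sq (orth_basis a) (orth_basis b)"

text \<open>\<open>cov a b\<close> is A times its adjoint, where A is the square matrix with columns
  \<open>a\<close> and \<open>b\<close>; its determinant is therefore |det A|^2.\<close>

lemma cov_det: "cov_p a b * cov_s a b - (cmod (cov_q a b))\<^sup>2 = (cmod (vdet a b))\<^sup>2"
  unfolding cov_p_def cov_s_def cov_q_def vdet_def cmod_power2
  by simp algebra

lemma herm_cov: "herm (cov_p a b) (cov_s a b) (cov_q a b) (cov a b)"
proof -
  have "(cmod (cov_q a b))\<^sup>2 \<le> cov_p a b * cov_s a b"
    using cov_det[of a b] by (smt (verit) zero_le_power2)
  then show ?thesis
    by (simp add: herm_def cov_def mult_cnj_eq del: of_real_power)
       (simp add: cov_p_def cov_s_def cov_q_def)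
qed

lemma cinner_cov: "cinner w (mat_vec (cov a b) w) = of_real ((cmod (cinner w a))\<^sup>2 + (cmod (cinner w b))\<^sup>2)"
  unfolding cinner_def mat_vec_def cov_def sum_lessThan_2 of_real_add mult_cnj_eq[symmetric]
  by (simp add: algebra_simps)

lemma leak_nonneg: "0 \<le> leak a b"
  unfolding leak_def by (rule eig_min_nonneg[OF herm_cov])

text \<open>Rayleigh quotient at a vector orthogonal to \<open>a\<close>.\<close>

lemma leak_le_det: "leak a b * (vnorm a)\<^sup>2 \<le> (cmod (vdet a b))\<^sup>2"
proof -
  define w :: cvec where "w = (\<lambda>r. if r = 0 then - cnj (a 1) else cnj (a 0))"
  have "leak a b * (vnorm w)\<^sup>2 \<le> Re (cinner w (mat_vec (cov a b) w))"
    unfolding leak_def by (rule eig_min_rayleigh[OF herm_cov])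
  also have "\<dots> = (cmod (cinner w a))\<^sup>2 + (cmod (cinner w b))\<^sup>2"
    by (simp only: cinner_cov Re_complex_of_real)
  also have "(vnorm w)\<^sup>2 = (vnorm a)\<^sup>2" by (simp add: vnorm_sq w_def)
  also have "cinner w a = 0" by (simp add: cinner_def sum_lessThan_2 w_def)
  also have "cinner w b = vdet a b" by (simp add: cinner_def sum_lessThan_2 w_def vdet_def)
  finally show ?thesis by simp
qed

lemma postfilter_cov:
  fixes a b
  defines "u \<equiv> postfilter (cov a b)"
  shows "vnorm u = 1"
    and "(cmod (cinner u a))\<^sup>2 + (cmod (cinner u b))\<^sup>2 = leak a b"
    and "gap a b * (cmod (u 0))\<^sup>2 = cov_s a b - leak a b"
    and "gap a b * (cmod (u 1))\<^sup>2 = cov_p a b - leak a b"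
    and "gap a b * (cmod (cinner u h))\<^sup>2 = gain_gap a b h"
proof -
  note * = postfilter_herm[OF herm_cov, of a b, folded u_def leak_def gap_def]
  show "vnorm u = 1" by fact
  show "(cmod (cinner u a))\<^sup>2 + (cmod (cinner u b))\<^sup>2 = leak a b"
    using *(2) by (simp only: cinner_cov Re_complex_of_real)
  show 3: "gap a b * (cmod (u 0))\<^sup>2 = cov_s a b - leak a b"
    and 4: "gap a b * (cmod (u 1))\<^sup>2 = cov_p a b - leak a b" by fact+
  \<comment> \<open>The gain depends on \<open>u\<close> only through the entries of u u*, and these
    become explicit after multiplication by the gap.\<close>
  have "(cmod (cinner u h))\<^sup>2 = (cmod (u 0))\<^sup>2 * (cmod (h 0))\<^sup>2 + (cmod (u 1))\<^sup>2 * (cmod (h 1))\<^sup>2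
      + 2 * Re (cnj (u 0 * cnj (u 1)) * h 0 * cnj (h 1))"
    unfolding cinner_def sum_lessThan_2 cmod_power2 by simp algebra
  moreover have re: "Re (cnj (of_real t * z) * x * y) = t * Re (cnj z * x * y)" for t x y z
    by (simp add: algebra_simps)
  ultimately have "gap a b * (cmod (cinner u h))\<^sup>2 =
      (gap a b * (cmod (u 0))\<^sup>2) * (cmod (h 0))\<^sup>2 + (gap a b * (cmod (u 1))\<^sup>2) * (cmod (h 1))\<^sup>2
      + 2 * Re (cnj (of_real (gap a b) * (u 0 * cnj (u 1))) * h 0 * cnj (h 1))"
    unfolding re by (simp only: distrib_left mult.assoc mult.left_commute[of "gap a b" 2])
  then show "gap a b * (cmod (cinner u h))\<^sup>2 = gain_gap a b h"
    unfolding 3 4 *(5) gain_gap_def by simp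
qed

text \<open>The squared gap equals (|a|^2 - |b|^2)^2 + 4 |a|^2 |b|^2 (1 - D): the eigenvalues
  coincide only for orthogonal vectors of equal length, where the metric is 1.\<close>

lemma gap_pos:
  assumes "vnorm a \<noteq> 0" "vnorm b \<noteq> 0" "chord a b < 1"
  shows "gap a b > 0"
proof -
  have "(vnorm a)\<^sup>2 * (vnorm b)\<^sup>2 > 0" using assms by simp
  then have "(cmod (vdet a b))\<^sup>2 < (vnorm a)\<^sup>2 * (vnorm b)\<^sup>2"
    using assms chordal_dist_sq_orth_basis[OF assms(1,2)] by (simp add: chord_def flip: chordal_dist_sq_orth_basis)
  moreover have "(gap a b)\<^sup>2 = ((vnorm a)\<^sup>2 + (vnorm b)\<^sup>2)\<^sup>2 - 4 * (cmod (vdet a b))\<^sup>2"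
    unfolding gap_def eig_gap_sq cov_det[symmetric] vnorm_sq cov_p_def cov_s_def by algebra
  moreover have "((vnorm a)\<^sup>2 + (vnorm b)\<^sup>2)\<^sup>2 - 4 * ((vnorm a)\<^sup>2 * (vnorm b)\<^sup>2) = ((vnorm a)\<^sup>2 - (vnorm b)\<^sup>2)\<^sup>2"
    by algebra
  ultimately have "(gap a b)\<^sup>2 > 0" by (smt (verit) zero_le_power2)
  then show ?thesis using eig_gap_nonneg by (simp add: gap_def less_le)
qed

lemma chord_nonneg: "chord a b \<ge> 0"
  by (simp add: chord_def chordal_dist_sq_def sum_nonneg)

lemma leak_le:
  assumes "vnorm a \<noteq> 0" "vnorm b \<noteq> 0"
  shows "leak a b \<le> chord a b * (vnorm b)\<^sup>2"
proof -
  have "leak a b * (vnorm a)\<^sup>2 \<le> (chord a b * (vnorm b)\<^sup>2) * (vnorm a)\<^sup>2"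
    using leak_le_det[of a b] chordal_dist_sq_orth_basis[OF assms] by (simp add: chord_def algebra_simps)
  then show ?thesis using assms(1) by (simp add: mult_le_cancel_right)
qed

lemma interf_props:
  assumes "i < 3"
  shows "interf1 i < 3" "interf2 i < 3" "interf1 i \<noteq> i" "interf2 i \<noteq> i" "interf1 i \<noteq> interf2 i"
    "{..<3} - {i} = {interf1 i, interf2 i}"
proof -
  have "i = 0 \<or> i = 1 \<or> i = 2" using assms by auto
  moreover have "interf1 0 = 1" "interf1 1 = 2" "interf1 2 = 0" "interf2 0 = 2" "interf2 1 = 0" "interf2 2 = 1"
    by (simp_all add: interf1_def interf2_def)
  ultimately show "interf1 i < 3" "interf2 i < 3" "interf1 i \<noteq> i" "interf2 i \<noteq> i" "interf1 i \<noteq> interf2 i"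
    "{..<3} - {i} = {interf1 i, interf2 i}"
    by auto
qed

lemma rate_eq:
  fixes \<omega> i k
  assumes "i < 3"
  defines "a \<equiv> chan \<omega> i (interf1 i) k" and "b \<equiv> chan \<omega> i (interf2 i) k" and "h \<equiv> chan \<omega> i i k"
  shows "rate P \<omega> i k = log 2 (1 + P * (cmod (cinner (postfilter (cov a b)) h))\<^sup>2 / (1 + P * leak a b))"
proof -
  have "interf_cov \<omega> i k = cov a b" by (simp add: interf_cov_def cov_def a_def b_def)
  then show ?thesis
    using interf_props[OF assms(1)] postfilter_cov(2)[of a b]
    by (simp add: rate_def a_def b_def h_def)
qed

lemma metric_D_eq: "metric_D \<omega> i k = chord (chan \<omega> i (interf1 i) k) (chan \<omega> i (interf2 i) k)"
  by (simp add: metric_D_def chord_def)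

lemma rate_nonneg: "i < 3 \<Longrightarrow> 0 \<le> P \<Longrightarrow> 0 \<le> rate P \<omega> i k"
  by (simp add: rate_eq leak_nonneg zero_le_log_cancel_iff add_pos_nonneg)

text \<open>By ln (1 + y) \<le> y, after dropping the interference. The bound is far from sharp and
  serves only to show that the expected rate is finite.\<close>

lemma rate_upper:
  assumes "i < 3" "0 \<le> P"
  shows "rate P \<omega> i k \<le> P * (vnorm (chan \<omega> i i k))\<^sup>2 / ln 2"
proof -
  define a b h where abh: "a = chan \<omega> i (interf1 i) k" "b = chan \<omega> i (interf2 i) k" "h = chan \<omega> i i k"
  define S where "S = P * (cmod (cinner (postfilter (cov a b)) h))\<^sup>2"
  have "0 \<le> S" using assms by (simp add: S_def)
  have "S \<le> P * (vnorm h)\<^sup>2"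
    using assms cinner_sq_le[of "postfilter (cov a b)" h] by (simp add: S_def postfilter_cov mult_left_mono)
  have l: "0 \<le> P * leak a b" using assms leak_nonneg by simp
  then have "S / (1 + P * leak a b) \<le> S" using \<open>0 \<le> S\<close>
    by (simp add: divide_le_eq mult_le_cancel_left1 distrib_left)
  moreover have "0 \<le> S / (1 + P * leak a b)" using l \<open>0 \<le> S\<close> by simp
  ultimately have "ln (1 + S / (1 + P * leak a b)) \<le> P * (vnorm h)\<^sup>2"
    using \<open>S \<le> _\<close> ln_add_one_self_le_self by (meson order_trans)
  then show ?thesis
    using rate_eq[OF assms(1), of P \<omega> k] by (simp add: log_def S_def abh divide_right_mono)
qed

text \<open>The rate grows with the filtered gain and falls with the leakage. The last hypothesis
  expresses that the gain is at least \<delta> without mentioning the postfilter; with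
  \<open>x \<le> 1\<close> the gap is positive and cancels.\<close>

lemma rate_lower:
  fixes \<omega> i k
  defines "a \<equiv> chan \<omega> i (interf1 i) k" and "b \<equiv> chan \<omega> i (interf2 i) k" and "h \<equiv> chan \<omega> i i k"
  assumes "i < 3" "0 < P" "x \<le> 1" "0 \<le> \<delta>" "metric_D \<omega> i k < x"
    and "a 0 \<noteq> 0" "b 0 \<noteq> 0" "(vnorm b)\<^sup>2 \<le> M" "\<delta> * gap a b \<le> gain_gap a b h"
  shows "log 2 (1 + P * \<delta> / (1 + P * (x * M))) \<le> rate P \<omega> i k"
proof -
  have nz: "vnorm a \<noteq> 0" "vnorm b \<noteq> 0"
    using vnorm_sq[of a] vnorm_sq[of b] assms(9,10) by (auto simp: add_nonneg_eq_0_iff)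
  have D: "chord a b < x" using assms by (simp add: metric_D_eq)
  define g where "g = (cmod (cinner (postfilter (cov a b)) h))\<^sup>2"
  have "\<delta> * gap a b \<le> g * gap a b"
    using assms(12) postfilter_cov(5)[of a b h] by (simp add: g_def mult.commute)
  then have g: "\<delta> \<le> g" using gap_pos[OF nz] D assms(6) by simp
  have "leak a b \<le> chord a b * (vnorm b)\<^sup>2" by (rule leak_le[OF nz])
  also have "\<dots> \<le> x * M" using D assms(11) chord_nonneg[of a b] by (intro mult_mono) auto
  finally have "leak a b \<le> x * M" .
  then have "P * \<delta> / (1 + P * (x * M)) \<le> P * g / (1 + P * leak a b)"
    using g assms(5,7) leak_nonneg[of a b]
    by (intro frac_le mult_mono add_mono) (auto simp: add_pos_nonneg)
  moreover have "0 \<le> P * \<delta> / (1 + P * (x * M))"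
    using assms(5,7) \<open>leak a b \<le> x * M\<close> leak_nonneg[of a b]
    by (intro divide_nonneg_nonneg) (auto intro!: add_nonneg_nonneg mult_nonneg_nonneg)
  ultimately show ?thesis
    using rate_eq[OF assms(4), of P \<omega> k] unfolding g_def a_def b_def h_def
    by simp
qed

section \<open>The complex Gaussian measure\<close>

definition half_gauss :: "real measure" where
  "half_gauss = density lborel (\<lambda>x. ennreal (normal_density 0 (sqrt (1/2)) x))"

lemma prob_space_half_gauss: "prob_space half_gauss"
  unfolding half_gauss_def by (rule prob_space_normal_density) simp

lemma cgauss_eq: "cgauss = distr (half_gauss \<Otimes>\<^sub>M half_gauss) borel (\<lambda>(a, b). Complex a b)"
proof -
  have "half_gauss \<Otimes>\<^sub>M half_gauss = density (lborel \<Otimes>\<^sub>M lborel)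
        (\<lambda>(a,b). ennreal (normal_density 0 (sqrt (1/2)) a) * ennreal (normal_density 0 (sqrt (1/2)) b))"
    unfolding half_gauss_def
    by (rule pair_measure_density)
       (auto intro: sigma_finite_lborel prob_space_imp_sigma_finite prob_space_half_gauss[unfolded half_gauss_def])
  then show ?thesis
    unfolding cgauss_def by (simp add: ennreal_mult normal_density_nonneg split_def)
qed

lemma measurable_Complex [measurable]: "(\<lambda>(a, b). Complex a b) \<in> borel \<Otimes>\<^sub>M borel \<rightarrow>\<^sub>M borel"
proof -
  have "(\<lambda>(a, b). Complex a b) = (\<lambda>p. of_real (fst p) + \<i> * of_real (snd p))"
    by (auto simp: complex_eq_iff)
  also have "\<dots> \<in> borel \<Otimes>\<^sub>M borel \<rightarrow>\<^sub>M borel" by measurable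
  finally show ?thesis .
qed

lemma sets_half_gauss [measurable_cong, simp]: "sets half_gauss = sets borel"
  by (simp add: half_gauss_def)

lemma space_half_gauss [simp]: "space half_gauss = UNIV"
  by (simp add: half_gauss_def)

lemma sets_cgauss [measurable_cong, simp]: "sets cgauss = sets borel"
  by (simp add: cgauss_def)

lemma space_cgauss [simp]: "space cgauss = UNIV"
  by (simp add: cgauss_def)

lemma prob_space_cgauss: "prob_space cgauss"
proof -
  interpret H: prob_space half_gauss by (rule prob_space_half_gauss)
  interpret P: pair_prob_space half_gauss half_gauss ..
  show ?thesis unfolding cgauss_eq by (rule P.prob_space_distr) measurable
qed

lemma normal_density_half: "normal_density 0 (sqrt (1/2)) x = exp (- x\<^sup>2) / sqrt pi"
  by (simp add: normal_density_def)

lemma cgauss_box: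
  assumes [measurable]: "A \<in> sets borel" "B \<in> sets borel"
  shows "emeasure cgauss {z. Re z \<in> A \<and> Im z \<in> B} = emeasure half_gauss A * emeasure half_gauss B"
proof -
  interpret H: prob_space half_gauss by (rule prob_space_half_gauss)
  have [measurable]: "{z. Re z \<in> A \<and> Im z \<in> B} \<in> sets borel"
    by (intro borel_measurable_Re borel_measurable_Im pred_Collect_borel) measurable
  have "emeasure cgauss {z. Re z \<in> A \<and> Im z \<in> B} = emeasure (half_gauss \<Otimes>\<^sub>M half_gauss) (A \<times> B)"
    unfolding cgauss_eq
    by (subst emeasure_distr) (auto simp: space_pair_measure intro!: arg_cong2[where f=emeasure])
  also have "\<dots> = emeasure half_gauss A * emeasure half_gauss B"
    by (rule H.emeasure_pair_measure_Times) auto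
  finally show ?thesis .
qed

lemma half_gauss_interval_le:
  assumes "0 \<le> r" shows "emeasure half_gauss {c - r..c + r} \<le> ennreal (2 * r)"
proof -
  have "emeasure half_gauss {c - r..c + r} =
      (\<integral>\<^sup>+ x. ennreal (normal_density 0 (sqrt (1/2)) x) * indicator {c - r..c + r} x \<partial>lborel)"
    unfolding half_gauss_def by (subst emeasure_density) auto
  also have "\<dots> \<le> (\<integral>\<^sup>+ x. indicator {c - r..c + r} x \<partial>lborel)"
  proof (intro nn_integral_mono)
    fix x :: real
    have "exp (- x\<^sup>2) \<le> 1" by simp
    moreover have "sqrt pi \<ge> 1" using pi_gt3 by simp
    ultimately have "normal_density 0 (sqrt (1/2)) x \<le> 1"
      unfolding normal_density_half by (subst divide_le_eq_1_pos) linarith+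
    then show "ennreal (normal_density 0 (sqrt (1/2)) x) * indicator {c - r..c + r} x \<le> indicator {c - r..c + r} x"
      by (auto simp: indicator_def)
  qed
  also have "\<dots> = ennreal (2 * r)" using assms by simp
  finally show ?thesis .
qed

text \<open>The value of the density of the real or imaginary part at 4, its minimum on [-4, 4].
  This interval covers the squares used below, with centres of modulus at most 3 and half-sides at
  most 1.\<close>

definition gauss_floor :: real where "gauss_floor = exp (- 16) / sqrt pi"

lemma half_gauss_interval_ge:
  assumes "0 \<le> r" "\<bar>c\<bar> + r \<le> 4" shows "ennreal (gauss_floor * (2 * r)) \<le> emeasure half_gauss {c - r..c + r}"
proof -
  have "ennreal (gauss_floor * (2 * r)) = (\<integral>\<^sup>+ x. ennreal gauss_floor * indicator {c - r..c + r} x \<partial>lborel)"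
    using assms by (simp add: nn_integral_cmult gauss_floor_def del: ennreal_numeral flip: ennreal_mult ennreal_numeral)
  also have "\<dots> \<le> (\<integral>\<^sup>+ x. ennreal (normal_density 0 (sqrt (1/2)) x) * indicator {c - r..c + r} x \<partial>lborel)"
  proof (intro nn_integral_mono)
    fix x :: real
    show "ennreal gauss_floor * indicator {c - r..c + r} x \<le> ennreal (normal_density 0 (sqrt (1/2)) x) * indicator {c - r..c + r} x"
    proof (cases "x \<in> {c - r..c + r}")
      case True
      then have "\<bar>x\<bar> \<le> 4" using assms by auto
      then have "x\<^sup>2 \<le> 4\<^sup>2" by (metis abs_le_square_iff abs_numeral)
      then show ?thesis using True
        by (simp add: normal_density_half gauss_floor_def divide_right_mono ennreal_leI)
    qed simp
  qed
  also have "\<dots> = emeasure half_gauss {c - r..c + r}"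
    unfolding half_gauss_def by (subst emeasure_density) auto
  finally show ?thesis .
qed

text \<open>The disc lies in a square of side 2 sqrt \<rho>, and the real density is at most
  1.\<close>

lemma cgauss_cball_le:
  assumes "0 \<le> \<rho>"
  shows "emeasure cgauss {y. (cmod (y - z))\<^sup>2 \<le> \<rho>} \<le> ennreal (4 * \<rho>)"
proof -
  let ?r = "sqrt \<rho>"
  have "{y. (cmod (y - z))\<^sup>2 \<le> \<rho>} \<subseteq> {y. Re y \<in> {Re z - ?r..Re z + ?r} \<and> Im y \<in> {Im z - ?r..Im z + ?r}}"
  proof safe
    fix y assume "(cmod (y - z))\<^sup>2 \<le> \<rho>"
    then have "cmod (y - z) \<le> ?r" by (rule real_le_rsqrt)
    then have "\<bar>Re (y - z)\<bar> \<le> ?r" "\<bar>Im (y - z)\<bar> \<le> ?r"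
      using abs_Re_le_cmod[of "y - z"] abs_Im_le_cmod[of "y - z"] by linarith+
    then show "Re y \<in> {Re z - ?r..Re z + ?r}" "Im y \<in> {Im z - ?r..Im z + ?r}" by auto
  qed
  then have "emeasure cgauss {y. (cmod (y - z))\<^sup>2 \<le> \<rho>} \<le>
     emeasure cgauss {y. Re y \<in> {Re z - ?r..Re z + ?r} \<and> Im y \<in> {Im z - ?r..Im z + ?r}}"
    by (intro emeasure_mono) auto
  also have "\<dots> \<le> ennreal (2 * ?r) * ennreal (2 * ?r)"
    using assms by (subst cgauss_box) (auto intro!: mult_mono half_gauss_interval_le)
  also have "\<dots> = ennreal (4 * \<rho>)" using assms by (simp flip: ennreal_mult)
  finally show ?thesis .
qed

text \<open>The disc contains the concentric square of half-side sqrt \<rho> / 2, whose corners are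
  at squared distance \<rho> / 2 from the centre; the strict inequality is thus met.\<close>

lemma cgauss_ball_ge:
  assumes "0 < \<rho>" "\<rho> \<le> 1" "cmod z \<le> 3"
  shows "ennreal (gauss_floor\<^sup>2 * \<rho>) \<le> emeasure cgauss {y. (cmod (y - z))\<^sup>2 < \<rho>}"
proof -
  let ?r = "sqrt \<rho> / 2"
  have r: "0 \<le> ?r" "?r \<le> 1" using assms by (auto simp: real_sqrt_le_1_iff intro: order_trans[of _ 1])
  have "{y. Re y \<in> {Re z - ?r..Re z + ?r} \<and> Im y \<in> {Im z - ?r..Im z + ?r}} \<subseteq> {y. (cmod (y - z))\<^sup>2 < \<rho>}"
  proof safe
    fix y assume "Re y \<in> {Re z - ?r..Re z + ?r}" "Im y \<in> {Im z - ?r..Im z + ?r}"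
    then have "\<bar>Re (y - z)\<bar> \<le> ?r" "\<bar>Im (y - z)\<bar> \<le> ?r"
      unfolding abs_le_iff by auto
    then have "(Re (y - z))\<^sup>2 \<le> ?r\<^sup>2" "(Im (y - z))\<^sup>2 \<le> ?r\<^sup>2"
      using r by (metis abs_le_square_iff abs_of_nonneg)+
    moreover have "?r\<^sup>2 = \<rho> / 4" using assms by (simp add: power_divide)
    ultimately show "(cmod (y - z))\<^sup>2 < \<rho>" using assms(1) unfolding cmod_power2 by linarith
  qed
  then have "emeasure cgauss {y. Re y \<in> {Re z - ?r..Re z + ?r} \<and> Im y \<in> {Im z - ?r..Im z + ?r}}
      \<le> emeasure cgauss {y. (cmod (y - z))\<^sup>2 < \<rho>}"
    by (intro emeasure_mono) auto
  moreover have bounds: "\<bar>Re z\<bar> + ?r \<le> 4" "\<bar>Im z\<bar> + ?r \<le> 4"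
    using assms r abs_Re_le_cmod[of z] abs_Im_le_cmod[of z] by linarith+
  moreover have "ennreal (gauss_floor * (2 * ?r)) * ennreal (gauss_floor * (2 * ?r)) \<le>
     emeasure cgauss {y. Re y \<in> {Re z - ?r..Re z + ?r} \<and> Im y \<in> {Im z - ?r..Im z + ?r}}"
    by (subst cgauss_box; (intro mult_mono half_gauss_interval_ge r bounds)?) simp_all
  moreover have "ennreal (gauss_floor * (2 * ?r)) * ennreal (gauss_floor * (2 * ?r)) = ennreal (gauss_floor\<^sup>2 * \<rho>)"
    using assms by (simp add: gauss_floor_def power2_eq_square flip: ennreal_mult)
  ultimately show ?thesis by simp
qed

lemma nn_integral_cgauss_pow4_finite: "(\<integral>\<^sup>+ z. ennreal ((cmod z)^4) \<partial>cgauss) < \<infinity>"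
proof -
  interpret H: prob_space half_gauss by (rule prob_space_half_gauss)
  have int: "(\<integral>\<^sup>+ x. ennreal (x^4) \<partial>half_gauss) < \<infinity>"
  proof -
    have "(\<integral>\<^sup>+ x. ennreal (x^4) \<partial>half_gauss) = (\<integral>\<^sup>+ x. ennreal (normal_density 0 (sqrt (1/2)) x * (x - 0)^4) \<partial>lborel)"
      unfolding half_gauss_def by (subst nn_integral_density) (auto simp: ennreal_mult)
    also have "\<dots> < \<infinity>"
      using integrable_normal_moment[of "sqrt (1/2)" 0 4]
      by (auto simp: integrable_iff_bounded normal_density_nonneg)
    finally show ?thesis .
  qed
  have "(\<integral>\<^sup>+ z. ennreal ((cmod z)^4) \<partial>cgauss) =
     (\<integral>\<^sup>+ p. ennreal ((cmod (Complex (fst p) (snd p)))^4) \<partial>(half_gauss \<Otimes>\<^sub>M half_gauss))"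
    unfolding cgauss_eq by (subst nn_integral_distr) (auto simp: split_def)
  also have "\<dots> \<le> (\<integral>\<^sup>+ p. 2 * ennreal (fst p ^ 4) + 2 * ennreal (snd p ^ 4) \<partial>(half_gauss \<Otimes>\<^sub>M half_gauss))"
  proof (intro nn_integral_mono)
    fix p :: "real \<times> real"
    obtain x y where p: "p = (x, y)" by fastforce
    have "(cmod (Complex x y))^4 = (x\<^sup>2 + y\<^sup>2)\<^sup>2"
      using cmod_power2[of "Complex x y"] power_mult[of "cmod (Complex x y)" 2 2] by simp
    also have "\<dots> \<le> 2 * x^4 + 2 * y^4"
      using sum_squares_bound[of "x\<^sup>2" "y\<^sup>2"] by (simp add: power2_sum flip: power_mult)
    finally have "ennreal ((cmod (Complex x y))^4) \<le> ennreal (2 * x^4 + 2 * y^4)" by (rule ennreal_leI)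
    then show "ennreal ((cmod (Complex (fst p) (snd p)))^4) \<le> 2 * ennreal (fst p ^ 4) + 2 * ennreal (snd p ^ 4)"
      by (simp add: p ennreal_plus ennreal_mult)
  qed
  also have "\<dots> = 2 * (\<integral>\<^sup>+ x. ennreal (x^4) \<partial>half_gauss) + 2 * (\<integral>\<^sup>+ x. ennreal (x^4) \<partial>half_gauss)"
  proof -
    have "(\<integral>\<^sup>+ p. ennreal (fst p ^ 4) \<partial>(half_gauss \<Otimes>\<^sub>M half_gauss)) = (\<integral>\<^sup>+ x. ennreal (x^4) \<partial>half_gauss)"
      by (subst H.nn_integral_fst[symmetric]) (auto simp: H.emeasure_space_1[simplified])
    moreover have "(\<integral>\<^sup>+ p. ennreal (snd p ^ 4) \<partial>(half_gauss \<Otimes>\<^sub>M half_gauss)) = (\<integral>\<^sup>+ x. ennreal (x^4) \<partial>half_gauss)"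
      by (subst H.nn_integral_fst[symmetric]) (auto simp: H.emeasure_space_1[simplified])
    ultimately show ?thesis by (simp add: nn_integral_add nn_integral_cmult)
  qed
  also have "\<dots> < \<infinity>" using int by (simp add: ennreal_mult_less_top)
  finally show ?thesis .
qed

section \<open>Resampling one channel coefficient\<close>

lemma finite_chan_idx: "finite (chan_idx K)"
  by (simp add: chan_idx_def)

lemma prob_space_chan_space: "prob_space (chan_space K)"
  unfolding chan_space_def by (rule prob_space_PiM) (rule prob_space_cgauss)

lemma measurable_coord:
  "c \<in> chan_idx K \<Longrightarrow> (\<lambda>\<omega>. \<omega> c) \<in> borel_measurable (chan_space K)"
  unfolding chan_space_def
  using measurable_component_singleton[of c "chan_idx K" "\<lambda>_. cgauss"]
  by (simp add: measurable_cong_sets[OF refl sets_cgauss])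

lemma measurable_resample:
  assumes "c \<in> chan_idx K"
  shows "(\<lambda>(x, y). x(c := y)) \<in> chan_space K \<Otimes>\<^sub>M cgauss \<rightarrow>\<^sub>M chan_space K"
  unfolding chan_space_def split_def
  using assms by (intro measurable_fun_upd[where J="chan_idx K"]) auto

text \<open>Replacing one coefficient by a fresh independent copy preserves the law. The inner
  integral ignores the old value at \<open>c\<close>, so integrating over that value contributes
  only the total mass 1.\<close>

lemma chan_resample:
  assumes c: "c \<in> chan_idx K" and f[measurable]: "f \<in> borel_measurable (chan_space K)"
  shows "(\<integral>\<^sup>+ x. f x \<partial>chan_space K) = (\<integral>\<^sup>+ x. (\<integral>\<^sup>+ y. f (x(c := y)) \<partial>cgauss) \<partial>chan_space K)"
proof -
  interpret C: prob_space cgauss by (rule prob_space_cgauss)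
  interpret P: product_sigma_finite "\<lambda>_. cgauss" ..
  note [measurable] = measurable_resample[OF c]
  have g[measurable]: "(\<lambda>x. \<integral>\<^sup>+ y. f (x(c := y)) \<partial>cgauss) \<in> borel_measurable (chan_space K)"
    using measurable_compose[OF measurable_resample[OF c] f]
    by (intro C.borel_measurable_nn_integral) (simp add: split_def)
  define I where "I = chan_idx K - {c}"
  have I: "finite I" "c \<notin> I" "chan_idx K = insert c I"
    using c finite_chan_idx by (auto simp: I_def)
  note ins = P.product_nn_integral_insert[OF I(1,2), folded I(3), folded chan_space_def]
  have "(\<integral>\<^sup>+ x. (\<integral>\<^sup>+ y. f (x(c := y)) \<partial>cgauss) \<partial>chan_space K) =
    (\<integral>\<^sup>+ x. (\<integral>\<^sup>+ z. (\<integral>\<^sup>+ y. f ((x(c := z))(c := y)) \<partial>cgauss) \<partial>cgauss) \<partial>PiM I (\<lambda>_. cgauss))"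
    by (rule ins[OF g])
  also have "\<dots> = (\<integral>\<^sup>+ x. (\<integral>\<^sup>+ y. f (x(c := y)) \<partial>cgauss) \<partial>PiM I (\<lambda>_. cgauss))"
    using C.emeasure_space_1 by simp
  also have "\<dots> = (\<integral>\<^sup>+ x. f x \<partial>chan_space K)" by (rule ins[OF f, symmetric])
  finally show ?thesis by simp
qed

lemma nn_integral_coord:
  assumes c: "c \<in> chan_idx K" and f[measurable]: "f \<in> borel_measurable borel"
  shows "(\<integral>\<^sup>+ \<omega>. f (\<omega> c) \<partial>chan_space K) = (\<integral>\<^sup>+ z. f z \<partial>cgauss)"
proof -
  have "cgauss = distr (chan_space K) cgauss (\<lambda>\<omega>. \<omega> c)"
    unfolding chan_space_def
    by (rule distr_PiM_component[symmetric]) (auto intro: prob_space_cgauss c)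
  then have "(\<integral>\<^sup>+ z. f z \<partial>cgauss) = (\<integral>\<^sup>+ z. f z \<partial>distr (chan_space K) cgauss (\<lambda>\<omega>. \<omega> c))" by simp
  also have "\<dots> = (\<integral>\<^sup>+ \<omega>. f (\<omega> c) \<partial>chan_space K)"
    using measurable_coord[OF c] f by (intro nn_integral_distr) (simp_all add: measurable_cong_sets[OF refl sets_cgauss] measurable_cong_sets[OF sets_cgauss refl])
  finally show ?thesis by simp
qed

text \<open>\<open>F\<close> bounds the conditional probability of the event given all coefficients
  but the one at \<open>c\<close>. Passing to a Borel superset \<open>B\<close> reduces the work to
  measuring discs.\<close>

lemma emeasure_resample_le:
  assumes c: "c \<in> chan_idx K"
    and Q[measurable]: "Measurable.pred (chan_space K) Q"
    and le: "\<And>\<omega>. \<omega> \<in> space (chan_space K) \<Longrightarrow>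
       \<exists>B\<in>sets borel. {y. Q (fun_upd \<omega> c y)} \<subseteq> B \<and> emeasure cgauss B \<le> F \<omega>"
  shows "emeasure (chan_space K) {\<omega>\<in>space (chan_space K). Q \<omega>} \<le> (\<integral>\<^sup>+ \<omega>. F \<omega> \<partial>chan_space K)"
proof -
  let ?S = "{\<omega>\<in>space (chan_space K). Q \<omega>}"
  have "emeasure (chan_space K) ?S = (\<integral>\<^sup>+ \<omega>. indicator ?S \<omega> \<partial>chan_space K)" by simp
  also have "\<dots> = (\<integral>\<^sup>+ x. (\<integral>\<^sup>+ y. indicator ?S (x(c := y)) \<partial>cgauss) \<partial>chan_space K)"
    by (rule chan_resample[OF c]) measurable
  also have "\<dots> \<le> (\<integral>\<^sup>+ \<omega>. F \<omega> \<partial>chan_space K)"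
  proof (intro nn_integral_mono)
    fix \<omega> assume "\<omega> \<in> space (chan_space K)"
    from le[OF this] obtain B where B: "B \<in> sets borel" "{y. Q (fun_upd \<omega> c y)} \<subseteq> B" "emeasure cgauss B \<le> F \<omega>"
      by blast
    have "(\<integral>\<^sup>+ y. indicator ?S (fun_upd \<omega> c y) \<partial>cgauss) \<le> (\<integral>\<^sup>+ y. indicator B y \<partial>cgauss)"
      using B(2) by (intro nn_integral_mono) (auto simp: indicator_def)
    also have "\<dots> \<le> F \<omega>" using B by simp
    finally show "(\<integral>\<^sup>+ y. indicator ?S (fun_upd \<omega> c y) \<partial>cgauss) \<le> F \<omega>" .
  qed
  finally show ?thesis .
qed

text \<open>One link of a chain rule: wherever \<open>Q'\<close> holds, redrawing the coefficient at
  \<open>c\<close> makes \<open>Q\<close> true with probability at least \<open>e\<close>.\<close>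

lemma emeasure_resample_ge:
  assumes c: "c \<in> chan_idx K"
    and Q[measurable]: "Measurable.pred (chan_space K) Q"
    and Q'[measurable]: "Measurable.pred (chan_space K) Q'"
    and ge: "\<And>\<omega>. \<omega> \<in> space (chan_space K) \<Longrightarrow> Q' \<omega> \<Longrightarrow>
       \<exists>B\<in>sets borel. B \<subseteq> {y. Q (fun_upd \<omega> c y)} \<and> e \<le> emeasure cgauss B"
  shows "e * emeasure (chan_space K) {\<omega>\<in>space (chan_space K). Q' \<omega>} \<le>
     emeasure (chan_space K) {\<omega>\<in>space (chan_space K). Q \<omega>}"
proof -
  let ?S = "{\<omega>\<in>space (chan_space K). Q \<omega>}" and ?S' = "{\<omega>\<in>space (chan_space K). Q' \<omega>}"
  have "e * emeasure (chan_space K) ?S' = (\<integral>\<^sup>+ \<omega>. e * indicator ?S' \<omega> \<partial>chan_space K)"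
    by (subst nn_integral_cmult_indicator) auto
  also have "\<dots> \<le> (\<integral>\<^sup>+ x. (\<integral>\<^sup>+ y. indicator ?S (x(c := y)) \<partial>cgauss) \<partial>chan_space K)"
  proof (intro nn_integral_mono)
    fix \<omega> assume w: "\<omega> \<in> space (chan_space K)"
    have up: "fun_upd \<omega> c y \<in> space (chan_space K)" for y
      using w c by (auto simp: chan_space_def space_PiM PiE_def extensional_def)
    show "e * indicator ?S' \<omega> \<le> (\<integral>\<^sup>+ y. indicator ?S (fun_upd \<omega> c y) \<partial>cgauss)"
    proof (cases "Q' \<omega>")
      case True
      from ge[OF w True] obtain B where B: "B \<in> sets borel" "B \<subseteq> {y. Q (fun_upd \<omega> c y)}" "e \<le> emeasure cgauss B"
        by blast
      have "e \<le> (\<integral>\<^sup>+ y. indicator B y \<partial>cgauss)" using B by simp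
      also have "\<dots> \<le> (\<integral>\<^sup>+ y. indicator ?S (fun_upd \<omega> c y) \<partial>cgauss)"
        using B(2) up by (intro nn_integral_mono) (auto simp: indicator_def)
      finally show ?thesis using True w by simp
    qed simp
  qed
  also have "\<dots> = (\<integral>\<^sup>+ \<omega>. indicator ?S \<omega> \<partial>chan_space K)"
    by (rule chan_resample[OF c, symmetric]) measurable
  also have "\<dots> = emeasure (chan_space K) ?S" by simp
  finally show ?thesis .
qed

section \<open>Measurability, and the metric as a function of one coefficient\<close>

lemma chan_upd_same: "chan (fun_upd \<omega> (i, j, k, r) y) i j k = (chan \<omega> i j k)(r := y)"
  by (auto simp: chan_def)

lemma chan_upd_other: "j \<noteq> j' \<Longrightarrow> chan (fun_upd \<omega> (i, j, k, r) y) i j' k = chan \<omega> i j' k"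
  by (auto simp: chan_def)

lemma borel_measurable_cnj [measurable (raw)]:
  "f \<in> borel_measurable M \<Longrightarrow> (\<lambda>x. cnj (f x)) \<in> borel_measurable M"
  by (rule borel_measurable_continuous_on[where f=cnj]) (auto intro: continuous_intros)

lemma borel_measurable_pred_le [measurable (raw)]:
  fixes f g :: "'a \<Rightarrow> real"
  shows "f \<in> borel_measurable M \<Longrightarrow> g \<in> borel_measurable M \<Longrightarrow> Measurable.pred M (\<lambda>x. f x \<le> g x)"
  unfolding Measurable.pred_def by (rule borel_measurable_le)

lemma borel_measurable_vnorm:
  assumes [measurable]: "(\<lambda>x. a x 0) \<in> borel_measurable M" "(\<lambda>x. a x 1) \<in> borel_measurable M"
  shows "(\<lambda>x. vnorm (a x)) \<in> borel_measurable M"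
  unfolding vnorm_def sum_lessThan_2 by measurable

lemma borel_measurable_chord:
  assumes [measurable]: "(\<lambda>x. a x 0) \<in> borel_measurable M" "(\<lambda>x. a x 1) \<in> borel_measurable M"
    "(\<lambda>x. b x 0) \<in> borel_measurable M" "(\<lambda>x. b x 1) \<in> borel_measurable M"
  shows "(\<lambda>x. chord (a x) (b x)) \<in> borel_measurable M"
proof -
  have [measurable]: "(\<lambda>x. vnorm (a x)) \<in> borel_measurable M" "(\<lambda>x. vnorm (b x)) \<in> borel_measurable M"
    by (intro borel_measurable_vnorm assms)+
  show ?thesis
    unfolding chord_def chordal_dist_sq_def orth_basis_def sum_lessThan_2 by measurable
qed

text \<open>
  If \<open>a r\<close> is the dominant entry of \<open>a\<close>, then, given \<open>a\<close> and \<open>b r\<close>, a small metric confines \<open>b r'\<close> to a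
  disc whose squared radius is proportional to \<open>x\<close>.
\<close>

lemma chord_section:
  assumes r: "(r, r') = (0, 1) \<or> (r, r') = (1, 0)"
    and x: "x \<le> 1/8" and D: "chord a b < x" and nz: "a r \<noteq> 0" "vnorm b \<noteq> 0"
    and le: "cmod (a r') \<le> cmod (a r)"
  shows "(cmod (b r' - a r' / a r * b r))\<^sup>2 \<le> 32 * x * (cmod (b r))\<^sup>2" "(vnorm b)\<^sup>2 \<le> 16 * (cmod (b r))\<^sup>2"
proof -
  define e where "e = b r' - a r' / a r * b r"
  have x0: "0 < x" using D chord_nonneg[of a b] by linarith
  have va: "(vnorm a)\<^sup>2 = (cmod (a r))\<^sup>2 + (cmod (a r'))\<^sup>2" and vb: "(vnorm b)\<^sup>2 = (cmod (b r))\<^sup>2 + (cmod (b r'))\<^sup>2"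
    using r by (auto simp: vnorm_sq)
  have "(cmod (a r'))\<^sup>2 \<le> (cmod (a r))\<^sup>2" using le by (simp add: power_mono)
  then have va2: "(vnorm a)\<^sup>2 \<le> 2 * (cmod (a r))\<^sup>2" by (simp add: va)
  have "vnorm a \<noteq> 0" using va nz(1) by (auto simp: add_nonneg_eq_0_iff)
  have "cmod (vdet a b) = cmod (a r * e)"
    using r nz(1) by (auto simp: vdet_def e_def right_diff_distrib norm_minus_commute)
  then have "(cmod (a r))\<^sup>2 * (cmod e)\<^sup>2 = (cmod (vdet a b))\<^sup>2" by (simp add: norm_mult power_mult_distrib)
  also have "\<dots> = chord a b * ((vnorm a)\<^sup>2 * (vnorm b)\<^sup>2)"
    using chordal_dist_sq_orth_basis[OF \<open>vnorm a \<noteq> 0\<close> nz(2)] by (simp add: chord_def)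
  also have "\<dots> \<le> x * (2 * (cmod (a r))\<^sup>2 * (vnorm b)\<^sup>2)"
    using D va2 x0 by (intro mult_mono) auto
  also have "\<dots> = (cmod (a r))\<^sup>2 * (2 * x * (vnorm b)\<^sup>2)" by simp
  finally have e: "(cmod e)\<^sup>2 \<le> 2 * x * (vnorm b)\<^sup>2" using nz(1) by (simp add: mult_le_cancel_left)
  \<comment> \<open>Here \<open>x \<le> 1/8\<close> makes the deviation \<open>e\<close> of
    \<open>b\<close> from the line through \<open>a\<close> at most |b| / 2. That half is absorbed
    on the left: |b| is at most 2 |b r| + |b| / 2, hence at most 4 |b r|, the source of the constant
    16.\<close>
  also have "\<dots> \<le> (1/4) * (vnorm b)\<^sup>2" using x by (intro mult_right_mono) auto
  also have "\<dots> = (vnorm b / 2)\<^sup>2" by (simp add: power_divide)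
  finally have e2: "cmod e \<le> vnorm b / 2" using vnorm_nonneg[of b] by (simp add: power2_le_iff_abs_le)
  have "cmod (a r' / a r) \<le> 1" using le nz(1) by (simp add: norm_divide)
  then have "cmod (a r' / a r * b r) \<le> cmod (b r)" by (simp only: norm_mult mult_left_le_one_le norm_ge_zero)
  moreover have "cmod (b r') \<le> cmod e + cmod (a r' / a r * b r)"
    using norm_triangle_ineq[of e "a r' / a r * b r"] by (simp add: e_def)
  moreover have "vnorm b \<le> cmod (b r) + cmod (b r')"
    by (rule power2_le_imp_le) (simp_all add: vb power2_sum)
  ultimately have "vnorm b \<le> 4 * cmod (b r)" using e2 by linarith
  then have "(vnorm b)\<^sup>2 \<le> (4 * cmod (b r))\<^sup>2" using vnorm_nonneg by (intro power_mono)
  then show vb16: "(vnorm b)\<^sup>2 \<le> 16 * (cmod (b r))\<^sup>2" by (simp add: power_mult_distrib)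
  have "2 * x * (vnorm b)\<^sup>2 \<le> 2 * x * (16 * (cmod (b r))\<^sup>2)" using vb16 x0 by (intro mult_left_mono) auto
  then show "(cmod (b r' - a r' / a r * b r))\<^sup>2 \<le> 32 * x * (cmod (b r))\<^sup>2"
    using e by (simp add: e_def)
qed

locale cell_user =
  fixes K i k :: nat
  assumes i: "i < 3" and k: "k < K"
begin

abbreviation "va \<omega> \<equiv> chan \<omega> i (interf1 i) k"
abbreviation "vb \<omega> \<equiv> chan \<omega> i (interf2 i) k"
abbreviation "vh \<omega> \<equiv> chan \<omega> i i k"

lemma idx: "j < 3 \<Longrightarrow> r < 2 \<Longrightarrow> (i, j, k, r) \<in> chan_idx K"
  using i k by (simp add: chan_idx_def)

lemma chan_measurable: "j < 3 \<Longrightarrow> r < 2 \<Longrightarrow> (\<lambda>\<omega>. chan \<omega> i j k r) \<in> borel_measurable (chan_space K)"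
  unfolding chan_def by (intro measurable_coord idx)

lemma chan_measurables [measurable]:
  "(\<lambda>\<omega>. va \<omega> 0) \<in> borel_measurable (chan_space K)" "(\<lambda>\<omega>. va \<omega> 1) \<in> borel_measurable (chan_space K)"
  "(\<lambda>\<omega>. vb \<omega> 0) \<in> borel_measurable (chan_space K)" "(\<lambda>\<omega>. vb \<omega> 1) \<in> borel_measurable (chan_space K)"
  "(\<lambda>\<omega>. vh \<omega> 0) \<in> borel_measurable (chan_space K)" "(\<lambda>\<omega>. vh \<omega> 1) \<in> borel_measurable (chan_space K)"
  by (intro chan_measurable interf_props i; simp)+

lemma chord_measurable [measurable]: "(\<lambda>\<omega>. chord (va \<omega>) (vb \<omega>)) \<in> borel_measurable (chan_space K)"
  by (intro borel_measurable_chord chan_measurables)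

lemma vnorm_measurable [measurable]: "(\<lambda>\<omega>. vnorm (vb \<omega>)) \<in> borel_measurable (chan_space K)"
  unfolding vnorm_def sum_lessThan_2 by measurable

lemma cov_measurable [measurable]:
  "(\<lambda>\<omega>. cov_p (va \<omega>) (vb \<omega>)) \<in> borel_measurable (chan_space K)"
  "(\<lambda>\<omega>. cov_s (va \<omega>) (vb \<omega>)) \<in> borel_measurable (chan_space K)"
  "(\<lambda>\<omega>. cov_q (va \<omega>) (vb \<omega>)) \<in> borel_measurable (chan_space K)"
  unfolding cov_p_def cov_s_def cov_q_def by measurable

lemma leak_measurable [measurable]:
  "(\<lambda>\<omega>. leak (va \<omega>) (vb \<omega>)) \<in> borel_measurable (chan_space K)"
  "(\<lambda>\<omega>. gap (va \<omega>) (vb \<omega>)) \<in> borel_measurable (chan_space K)"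
  unfolding leak_def gap_def eig_min_def eig_gap_def by measurable

lemma gain_gap_measurable [measurable]:
  "(\<lambda>\<omega>. gain_gap (va \<omega>) (vb \<omega>) (vh \<omega>)) \<in> borel_measurable (chan_space K)"
  unfolding gain_gap_def by measurable

text \<open>A simple condition, true almost surely, under which neither vector is 0. Then
  \<open>orth_basis\<close> is a genuine unit vector and not the default value of a division by
  zero.\<close>

definition "proper \<omega> \<longleftrightarrow> va \<omega> 0 \<noteq> 0 \<and> vb \<omega> 0 \<noteq> 0"

lemma proper_measurable [measurable]: "Measurable.pred (chan_space K) proper"
  unfolding proper_def by measurable

end

section \<open>Single-user probabilities\<close>

context cell_user
begin

lemma emeasure_coord_zero:
  assumes "j < 3" "r < 2"
  shows "emeasure (chan_space K) {\<omega>\<in>space (chan_space K). chan \<omega> i j k r = 0} = 0"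
proof -
  have "emeasure (chan_space K) {\<omega>\<in>space (chan_space K). chan \<omega> i j k r = 0} =
    (\<integral>\<^sup>+ \<omega>. indicator {0} (\<omega> (i, j, k, r)) \<partial>chan_space K)"
  proof -
    let ?S = "{\<omega>\<in>space (chan_space K). chan \<omega> i j k r = 0}"
    have [measurable]: "(\<lambda>\<omega>. chan \<omega> i j k r) \<in> borel_measurable (chan_space K)"
      by (rule chan_measurable[OF assms])
    have "emeasure (chan_space K) ?S = (\<integral>\<^sup>+ \<omega>. indicator ?S \<omega> \<partial>chan_space K)"
      by (rule nn_integral_indicator[symmetric]) measurable
    also have "\<dots> = (\<integral>\<^sup>+ \<omega>. indicator {0} (\<omega> (i, j, k, r)) \<partial>chan_space K)"
      by (intro nn_integral_cong) (auto simp: chan_def indicator_def)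
    finally show ?thesis .
  qed
  also have "\<dots> = (\<integral>\<^sup>+ z. indicator {0} z \<partial>cgauss)"
    by (rule nn_integral_coord[OF idx[OF assms]]) simp
  also have "\<dots> \<le> emeasure cgauss {y. (cmod (y - 0))\<^sup>2 \<le> 0}"
    by simp
  also have "\<dots> \<le> ennreal (4 * 0)" by (rule cgauss_cball_le) simp
  finally show ?thesis by simp
qed

text \<open>The coefficient \<open>b r'\<close> is redrawn. Given the rest, it must fall into a disc
  of squared radius 32 x |b r|^2, of probability at most 128 x |b r|^2. A large |b|^2 forces a large
  16 |b r|^2, a condition on a coefficient that is not redrawn, so the truncation survives as an
  indicator.\<close>

lemma chord_tail_half:
  assumes r: "(r, r') = (0, 1) \<or> (r, r') = (1, 0)" and x: "0 \<le> x" "x \<le> 1/8"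
  shows "emeasure (chan_space K) {\<omega>\<in>space (chan_space K).
       chord (va \<omega>) (vb \<omega>) < x \<and> proper \<omega> \<and> (vnorm (vb \<omega>))\<^sup>2 \<ge> M \<and> cmod (va \<omega> r') \<le> cmod (va \<omega> r)}
    \<le> (\<integral>\<^sup>+ z. ennreal (128 * x * (cmod z)\<^sup>2) * indicator {z. M \<le> 16 * (cmod z)\<^sup>2} z \<partial>cgauss)"
proof -
  let ?j = "interf2 i"
  let ?Q = "\<lambda>\<omega>. chord (va \<omega>) (vb \<omega>) < x \<and> proper \<omega> \<and> (vnorm (vb \<omega>))\<^sup>2 \<ge> M \<and> cmod (va \<omega> r') \<le> cmod (va \<omega> r)"
  let ?F = "\<lambda>z. ennreal (128 * x * (cmod z)\<^sup>2) * indicator {z. M \<le> 16 * (cmod z)\<^sup>2} z"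
  have r2: "r < 2" "r' < 2" "r \<noteq> r'" using r by auto
  have j: "?j < 3" "?j \<noteq> interf1 i" using interf_props[OF i] by auto
  have [measurable]: "(\<lambda>\<omega>. va \<omega> r) \<in> borel_measurable (chan_space K)" "(\<lambda>\<omega>. va \<omega> r') \<in> borel_measurable (chan_space K)"
    using r by auto
  have "emeasure (chan_space K) {\<omega>\<in>space (chan_space K). ?Q \<omega>} \<le> (\<integral>\<^sup>+ \<omega>. ?F (\<omega> (i, ?j, k, r)) \<partial>chan_space K)"
  proof (rule emeasure_resample_le[OF idx[OF j(1) r2(2)]])
    show "Measurable.pred (chan_space K) ?Q" by measurable
  next
    fix \<omega> :: "nat \<times> nat \<times> nat \<times> nat \<Rightarrow> complex"
    define z where "z = \<omega> (i, ?j, k, r)"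
    have z: "vb \<omega> r = z" by (simp add: z_def chan_def)
    define B where "B = (if M \<le> 16 * (cmod z)\<^sup>2 then {y. (cmod (y - va \<omega> r' / va \<omega> r * z))\<^sup>2 \<le> 32 * x * (cmod z)\<^sup>2} else {})"
    have B: "B \<in> sets borel" unfolding B_def by auto
    have "emeasure cgauss B \<le> ?F z"
      using cgauss_cball_le[of "32 * x * (cmod z)\<^sup>2" "va \<omega> r' / va \<omega> r * z"] x
      by (auto simp: B_def algebra_simps)
    moreover have "{y. ?Q (fun_upd \<omega> (i, ?j, k, r') y)} \<subseteq> B"
    proof
      fix y assume "y \<in> {y. ?Q (fun_upd \<omega> (i, ?j, k, r') y)}"
      then have Q: "?Q (fun_upd \<omega> (i, ?j, k, r') y)" by simp
      define b where "b = (vb \<omega>)(r' := y)"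
      have u: "vb (fun_upd \<omega> (i, ?j, k, r') y) = b" "va (fun_upd \<omega> (i, ?j, k, r') y) = va \<omega>"
        using j by (simp_all add: chan_upd_same chan_upd_other b_def)
      have b: "b r = z" "b r' = y" using r2 z by (auto simp: b_def)
      have nz: "va \<omega> 0 \<noteq> 0" "b 0 \<noteq> 0" using Q by (auto simp: proper_def u)
      have ar: "va \<omega> r \<noteq> 0" using r nz(1) Q by (auto simp: u)
      have "vnorm b \<noteq> 0" using nz(2) vnorm_sq[of b] by (auto simp: add_nonneg_eq_0_iff)
      note s = chord_section[where a = "va \<omega>" and b = b, OF r x(2) _ ar this, unfolded b]
      show "y \<in> B" using s Q by (auto simp: B_def u)
    qed
    ultimately show "\<exists>B\<in>sets borel. {y. ?Q (fun_upd \<omega> (i, ?j, k, r') y)} \<subseteq> B \<and> emeasure cgauss B \<le> ?F (\<omega> (i, ?j, k, r))"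
      using B unfolding z_def by blast
  qed
  also have "\<dots> = (\<integral>\<^sup>+ z. ?F z \<partial>cgauss)"
    by (rule nn_integral_coord[OF idx[OF j(1) r2(1)]]) measurable
  finally show ?thesis .
qed

lemma chord_tail:
  assumes x: "0 \<le> x" "x \<le> 1/8"
  shows "emeasure (chan_space K) {\<omega>\<in>space (chan_space K).
       chord (va \<omega>) (vb \<omega>) < x \<and> proper \<omega> \<and> (vnorm (vb \<omega>))\<^sup>2 \<ge> M}
    \<le> 2 * (\<integral>\<^sup>+ z. ennreal (128 * x * (cmod z)\<^sup>2) * indicator {z. M \<le> 16 * (cmod z)\<^sup>2} z \<partial>cgauss)"
proof -
  let ?E = "\<lambda>r r'. {\<omega>\<in>space (chan_space K).
       chord (va \<omega>) (vb \<omega>) < x \<and> proper \<omega> \<and> (vnorm (vb \<omega>))\<^sup>2 \<ge> M \<and> cmod (va \<omega> r') \<le> cmod (va \<omega> r)}"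
  have "emeasure (chan_space K) {\<omega>\<in>space (chan_space K).
       chord (va \<omega>) (vb \<omega>) < x \<and> proper \<omega> \<and> (vnorm (vb \<omega>))\<^sup>2 \<ge> M} \<le> emeasure (chan_space K) (?E 0 1 \<union> ?E 1 0)"
    by (intro emeasure_mono subsetI) auto
  also have "\<dots> \<le> emeasure (chan_space K) (?E 0 1) + emeasure (chan_space K) (?E 1 0)"
    by (rule emeasure_subadditive) measurable
  also have "\<dots> \<le> 2 * (\<integral>\<^sup>+ z. ennreal (128 * x * (cmod z)\<^sup>2) * indicator {z. M \<le> 16 * (cmod z)\<^sup>2} z \<partial>cgauss)"
    unfolding mult_2 by (intro add_mono chord_tail_half x) simp_all
  finally show ?thesis .
qed

text \<open>The coefficient \<open>h r\<close> is redrawn while \<open>a\<close> and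
  \<open>b\<close> stay fixed, so the probability of reporting survives as a factor. The last
  condition of the event says that |u r|^2 is at least 1/2; a gain below \<delta> then confines
  \<open>h r\<close> to a disc of squared radius 2 \<delta>.\<close>

lemma gain_tail_half:
  fixes r r' :: nat
  assumes r: "(r, r') = (0, 1) \<or> (r, r') = (1, 0)" and x: "x \<le> 1" and d: "0 \<le> \<delta>"
  shows "emeasure (chan_space K) {\<omega>\<in>space (chan_space K).
       chord (va \<omega>) (vb \<omega>) < x \<and> proper \<omega> \<and> gain_gap (va \<omega>) (vb \<omega>) (vh \<omega>) < \<delta> * gap (va \<omega>) (vb \<omega>) \<and>
       gap (va \<omega>) (vb \<omega>) \<le> 2 * (if r = 0 then cov_s (va \<omega>) (vb \<omega>) - leak (va \<omega>) (vb \<omega>) else cov_p (va \<omega>) (vb \<omega>) - leak (va \<omega>) (vb \<omega>))}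
    \<le> ennreal (8 * \<delta>) * emeasure (chan_space K) {\<omega>\<in>space (chan_space K). chord (va \<omega>) (vb \<omega>) < x \<and> proper \<omega>}"
proof -
  let ?Q = "\<lambda>\<omega>. chord (va \<omega>) (vb \<omega>) < x \<and> proper \<omega> \<and> gain_gap (va \<omega>) (vb \<omega>) (vh \<omega>) < \<delta> * gap (va \<omega>) (vb \<omega>) \<and>
       gap (va \<omega>) (vb \<omega>) \<le> 2 * (if r = 0 then cov_s (va \<omega>) (vb \<omega>) - leak (va \<omega>) (vb \<omega>) else cov_p (va \<omega>) (vb \<omega>) - leak (va \<omega>) (vb \<omega>))"
  let ?R = "\<lambda>\<omega>. chord (va \<omega>) (vb \<omega>) < x \<and> proper \<omega>"
  have r2: "r < 2" "r' < 2" "r \<noteq> r'" using r by auto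
  have "emeasure (chan_space K) {\<omega>\<in>space (chan_space K). ?Q \<omega>} \<le>
     (\<integral>\<^sup>+ \<omega>. ennreal (8 * \<delta>) * indicator {\<omega>\<in>space (chan_space K). ?R \<omega>} \<omega> \<partial>chan_space K)"
  proof (rule emeasure_resample_le[OF idx[OF i r2(1)]])
    show "Measurable.pred (chan_space K) ?Q" by measurable
  next
    fix \<omega> assume w: "\<omega> \<in> space (chan_space K)"
    define a b where "a = va \<omega>" and "b = vb \<omega>"
    define u where "u = postfilter (cov a b)"
    \<comment> \<open>The value of \<open>h r\<close> at which the filtered desired signal
      vanishes.\<close>
    define c where "c = - (cnj (u r') * vh \<omega> r' / cnj (u r))"
    define B where "B = (if ?R \<omega> then {y. (cmod (y - c))\<^sup>2 \<le> 2 * \<delta>} else {})"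
    have B: "B \<in> sets borel" unfolding B_def by auto
    have "emeasure cgauss B \<le> ennreal (8 * \<delta>) * indicator {\<omega>\<in>space (chan_space K). ?R \<omega>} \<omega>"
      using cgauss_cball_le[of "2 * \<delta>" c] d w by (auto simp: B_def)
    moreover have "{y. ?Q (fun_upd \<omega> (i, i, k, r) y)} \<subseteq> B"
    proof
      fix y assume "y \<in> {y. ?Q (fun_upd \<omega> (i, i, k, r) y)}"
      then have Q: "?Q (fun_upd \<omega> (i, i, k, r) y)" by simp
      define h where "h = (vh \<omega>)(r := y)"
      have up: "vb (fun_upd \<omega> (i, i, k, r) y) = b" "va (fun_upd \<omega> (i, i, k, r) y) = a" "vh (fun_upd \<omega> (i, i, k, r) y) = h"
        using interf_props[OF i] by (simp_all add: chan_upd_same chan_upd_other a_def b_def h_def)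
      have Rw: "?R \<omega>" using Q by (simp add: proper_def up flip: a_def b_def)
      have "vnorm a \<noteq> 0" "vnorm b \<noteq> 0"
        using Rw vnorm_sq[of a] vnorm_sq[of b] by (auto simp: proper_def a_def b_def add_nonneg_eq_0_iff)
      then have g: "gap a b > 0" using gap_pos Rw x by (simp add: a_def b_def)
      have "gap a b * (cmod (cinner u h))\<^sup>2 < gap a b * \<delta>"
        using Q unfolding up u_def postfilter_cov(5) by (simp add: mult.commute)
      then have less: "(cmod (cinner u h))\<^sup>2 < \<delta>" using g by simp
      have "gap a b * 1 \<le> gap a b * (2 * (cmod (u r))\<^sup>2)"
        using Q r postfilter_cov(3,4)[of a b] unfolding up u_def by auto
      then have ur: "1 \<le> 2 * (cmod (u r))\<^sup>2" using g by (simp only: mult_le_cancel_left_pos)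
      then have "u r \<noteq> 0" by auto
      then have "cnj (u r) * (y - c) = cnj (u r) * y + cnj (u r') * vh \<omega> r'"
        by (simp add: c_def field_simps)
      also have "\<dots> = cinner u h" using r by (auto simp: cinner_def sum_lessThan_2 h_def)
      finally have "(cmod (u r))\<^sup>2 * (cmod (y - c))\<^sup>2 < \<delta>"
        using less by (metis complex_mod_cnj norm_mult power_mult_distrib)
      moreover have "1 * (cmod (y - c))\<^sup>2 \<le> 2 * (cmod (u r))\<^sup>2 * (cmod (y - c))\<^sup>2"
        by (intro mult_right_mono ur) simp
      ultimately show "y \<in> B" using Rw by (simp add: B_def)
    qed
    ultimately show "\<exists>B\<in>sets borel. {y. ?Q (fun_upd \<omega> (i, i, k, r) y)} \<subseteq> B \<and>
       emeasure cgauss B \<le> ennreal (8 * \<delta>) * indicator {\<omega>\<in>space (chan_space K). ?R \<omega>} \<omega>"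
      using B by blast
  qed
  also have "\<dots> = ennreal (8 * \<delta>) * emeasure (chan_space K) {\<omega>\<in>space (chan_space K). ?R \<omega>}"
    by (rule nn_integral_cmult_indicator) measurable
  finally show ?thesis .
qed

text \<open>The two differences add up to the gap, so at least one of them is half of it or more:
  one entry of the postfilter always has squared modulus at least 1/2.\<close>

lemma gain_tail:
  assumes x: "x \<le> 1" and d: "0 \<le> \<delta>"
  shows "emeasure (chan_space K) {\<omega>\<in>space (chan_space K).
       chord (va \<omega>) (vb \<omega>) < x \<and> proper \<omega> \<and> gain_gap (va \<omega>) (vb \<omega>) (vh \<omega>) < \<delta> * gap (va \<omega>) (vb \<omega>)}
    \<le> ennreal (16 * \<delta>) * emeasure (chan_space K) {\<omega>\<in>space (chan_space K). chord (va \<omega>) (vb \<omega>) < x \<and> proper \<omega>}"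
proof -
  let ?E = "\<lambda>r. {\<omega>\<in>space (chan_space K).
       chord (va \<omega>) (vb \<omega>) < x \<and> proper \<omega> \<and> gain_gap (va \<omega>) (vb \<omega>) (vh \<omega>) < \<delta> * gap (va \<omega>) (vb \<omega>) \<and>
       gap (va \<omega>) (vb \<omega>) \<le> 2 * (if r = (0::nat) then cov_s (va \<omega>) (vb \<omega>) - leak (va \<omega>) (vb \<omega>) else cov_p (va \<omega>) (vb \<omega>) - leak (va \<omega>) (vb \<omega>))}"
  have "gap a b = (cov_p a b - leak a b) + (cov_s a b - leak a b)" for a b
    by (simp add: gap_def leak_def eig_gap_eq)
  then have "gap a b \<le> 2 * (cov_s a b - leak a b) \<or> gap a b \<le> 2 * (cov_p a b - leak a b)" for a b
    by (smt (verit))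
  then have "emeasure (chan_space K) {\<omega>\<in>space (chan_space K).
       chord (va \<omega>) (vb \<omega>) < x \<and> proper \<omega> \<and> gain_gap (va \<omega>) (vb \<omega>) (vh \<omega>) < \<delta> * gap (va \<omega>) (vb \<omega>)}
      \<le> emeasure (chan_space K) (?E 0 \<union> ?E 1)"
    by (intro emeasure_mono subsetI) auto
  also have "\<dots> \<le> emeasure (chan_space K) (?E 0) + emeasure (chan_space K) (?E 1)"
    by (rule emeasure_subadditive) measurable
  also have "\<dots> \<le> 2 * (ennreal (8 * \<delta>) * emeasure (chan_space K) {\<omega>\<in>space (chan_space K). chord (va \<omega>) (vb \<omega>) < x \<and> proper \<omega>})"
    unfolding mult_2
    using gain_tail_half[of 0 1, OF _ x d] gain_tail_half[of 1 0, OF _ x d] by (intro add_mono) simp_all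
  also have "\<dots> = (2 * ennreal (8 * \<delta>)) * emeasure (chan_space K) {\<omega>\<in>space (chan_space K). chord (va \<omega>) (vb \<omega>) < x \<and> proper \<omega>}"
    by (simp add: mult.assoc)
  also have "2 * ennreal (8 * \<delta>) = ennreal (16 * \<delta>)"
    using ennreal_mult[of 2 "8 * \<delta>"] d by simp
  finally show ?thesis .
qed

text \<open>The four coefficients are drawn one after another. With \<open>a 0\<close> and
  \<open>b 0\<close> within 1 of 2 and \<open>a 1\<close> within 1 of 0, each at a cost of
  \<open>gauss_floor\<close> squared, both vectors are bounded away from 0; the last coefficient
  then only has to hit a disc of squared radius \<open>x\<close>.\<close>

lemma chord_prob_ge:
  assumes x: "0 < x" "x \<le> 1"
  shows "ennreal (gauss_floor^8 * x) \<le> emeasure (chan_space K) {\<omega>\<in>space (chan_space K). chord (va \<omega>) (vb \<omega>) < x}"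
proof -
  interpret prob_space "chan_space K" by (rule prob_space_chan_space)
  let ?p = "interf1 i" and ?q = "interf2 i"
  note ip = interf_props[OF i]
  let ?C1 = "\<lambda>\<omega>. (cmod (va \<omega> 0 - 2))\<^sup>2 < 1"
  let ?C2 = "\<lambda>\<omega>. ?C1 \<omega> \<and> (cmod (va \<omega> 1 - 0))\<^sup>2 < 1"
  let ?C3 = "\<lambda>\<omega>. ?C2 \<omega> \<and> (cmod (vb \<omega> 0 - 2))\<^sup>2 < 1"
  let ?S = "\<lambda>C. {\<omega>\<in>space (chan_space K). C \<omega>}"
  have "ennreal (gauss_floor\<^sup>2) * emeasure (chan_space K) (?S (\<lambda>_. True)) \<le> emeasure (chan_space K) (?S ?C1)"
  proof (rule emeasure_resample_ge[of "(i, ?p, k, 0)"])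
    show "\<exists>B\<in>sets borel. B \<subseteq> {y. ?C1 (fun_upd \<omega> (i, ?p, k, 0) y)} \<and> ennreal (gauss_floor\<^sup>2) \<le> emeasure cgauss B" for \<omega>
      using cgauss_ball_ge[of 1 2]
      by (intro bexI[of _ "{y. (cmod (y - 2))\<^sup>2 < 1}"]) (auto simp: chan_upd_same)
  qed (use idx ip in \<open>simp_all | measurable\<close>)
  then have 1: "ennreal (gauss_floor\<^sup>2) \<le> emeasure (chan_space K) (?S ?C1)"
    by (simp add: emeasure_space_1)
  have 2: "ennreal (gauss_floor\<^sup>2) * emeasure (chan_space K) (?S ?C1) \<le> emeasure (chan_space K) (?S ?C2)"
  proof (rule emeasure_resample_ge[of "(i, ?p, k, 1)"])
    show "\<exists>B\<in>sets borel. B \<subseteq> {y. ?C2 (fun_upd \<omega> (i, ?p, k, 1) y)} \<and> ennreal (gauss_floor\<^sup>2) \<le> emeasure cgauss B"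
      if "?C1 \<omega>" for \<omega>
      using cgauss_ball_ge[of 1 0] that
      by (intro bexI[of _ "{y. (cmod (y - 0))\<^sup>2 < 1}"]) (auto simp: chan_upd_same)
  qed (use idx ip in \<open>simp_all | measurable\<close>)
  have 3: "ennreal (gauss_floor\<^sup>2) * emeasure (chan_space K) (?S ?C2) \<le> emeasure (chan_space K) (?S ?C3)"
  proof (rule emeasure_resample_ge[of "(i, ?q, k, 0)"])
    show "\<exists>B\<in>sets borel. B \<subseteq> {y. ?C3 (fun_upd \<omega> (i, ?q, k, 0) y)} \<and> ennreal (gauss_floor\<^sup>2) \<le> emeasure cgauss B"
      if "?C2 \<omega>" for \<omega>
      using cgauss_ball_ge[of 1 2] that ip
      by (intro bexI[of _ "{y. (cmod (y - 2))\<^sup>2 < 1}"]) (auto simp: chan_upd_same chan_upd_other)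
  qed (use idx ip in \<open>simp_all | measurable\<close>)
  have 4: "ennreal (gauss_floor\<^sup>2 * x) * emeasure (chan_space K) (?S ?C3)
     \<le> emeasure (chan_space K) (?S (\<lambda>\<omega>. chord (va \<omega>) (vb \<omega>) < x))"
  proof (rule emeasure_resample_ge[of "(i, ?q, k, 1)"])
    show "\<exists>B\<in>sets borel. B \<subseteq> {y. chord (va (fun_upd \<omega> (i, ?q, k, 1) y)) (vb (fun_upd \<omega> (i, ?q, k, 1) y)) < x} \<and>
       ennreal (gauss_floor\<^sup>2 * x) \<le> emeasure cgauss B"
      if C: "?C3 \<omega>" for \<omega>
    proof -
      define a where "a = va \<omega>"
      define z where "z = vb \<omega> 0"
      \<comment> \<open>The value of \<open>b 1\<close> that makes \<open>b\<close> parallel to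
        \<open>a\<close>. Its modulus is at most 3, as the lower bound for discs requires.\<close>
      define c where "c = a 1 / a 0 * z"
      have lt: "cmod (a 0 - 2) < 1" "cmod (a 1) < 1" "cmod (z - 2) < 1"
        using C by (auto simp: a_def z_def abs_square_less_1)
      have a0: "1 \<le> cmod (a 0)" using lt(1) norm_triangle_ineq2[of 2 "a 0"] by (simp add: norm_minus_commute)
      have z1: "1 \<le> cmod z" using lt(3) norm_triangle_ineq2[of 2 z] by (simp add: norm_minus_commute)
      have z3: "cmod z \<le> 3" using lt(3) norm_triangle_ineq2[of z 2] by simp
      have "cmod (a 1 / a 0) \<le> 1" using lt(2) a0 by (simp add: norm_divide divide_le_eq)
      then have "cmod c \<le> 1 * 3" unfolding c_def norm_mult using z3 by (intro mult_mono) auto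
      then have "ennreal (gauss_floor\<^sup>2 * x) \<le> emeasure cgauss {y. (cmod (y - c))\<^sup>2 < x}"
        using x by (intro cgauss_ball_ge) auto
      moreover have "{y. (cmod (y - c))\<^sup>2 < x} \<subseteq>
         {y. chord (va (fun_upd \<omega> (i, ?q, k, 1) y)) (vb (fun_upd \<omega> (i, ?q, k, 1) y)) < x}"
      proof safe
        fix y assume y: "(cmod (y - c))\<^sup>2 < x"
        define b where "b = (vb \<omega>)(1 := y)"
        have up: "vb (fun_upd \<omega> (i, ?q, k, 1) y) = b" "va (fun_upd \<omega> (i, ?q, k, 1) y) = a"
          using ip by (simp_all add: chan_upd_same chan_upd_other b_def a_def)
        have b: "b 0 = z" "b 1 = y" by (auto simp: b_def z_def)
        have "a 0 \<noteq> 0" "z \<noteq> 0" using a0 z1 by auto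
        then have nz: "vnorm a \<noteq> 0" "vnorm b \<noteq> 0"
          using vnorm_sq[of a] vnorm_sq[of b] b by (auto simp: add_nonneg_eq_0_iff)
        have "vdet a b = a 0 * (y - c)" using \<open>a 0 \<noteq> 0\<close> by (simp add: vdet_def b c_def field_simps)
        then have "(cmod (vdet a b))\<^sup>2 = (cmod (a 0))\<^sup>2 * (cmod (y - c))\<^sup>2" by (simp add: norm_mult power_mult_distrib)
        also have "\<dots> < (cmod (a 0))\<^sup>2 * x" using y \<open>a 0 \<noteq> 0\<close> by simp
        also have "\<dots> \<le> ((vnorm a)\<^sup>2 * (vnorm b)\<^sup>2) * x"
        proof (intro mult_right_mono)
          have "1 \<le> (vnorm b)\<^sup>2" using z1 by (simp add: vnorm_sq b add_increasing2 one_le_power)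
          moreover have "(cmod (a 0))\<^sup>2 \<le> (vnorm a)\<^sup>2" by (simp add: vnorm_sq)
          ultimately show "(cmod (a 0))\<^sup>2 \<le> (vnorm a)\<^sup>2 * (vnorm b)\<^sup>2"
            using mult_mono[of "(cmod (a 0))\<^sup>2" "(vnorm a)\<^sup>2" 1 "(vnorm b)\<^sup>2"] by simp
        qed (use x in simp)
        finally have "chord a b * ((vnorm a)\<^sup>2 * (vnorm b)\<^sup>2) < x * ((vnorm a)\<^sup>2 * (vnorm b)\<^sup>2)"
          using chordal_dist_sq_orth_basis[OF nz] by (simp add: chord_def mult.commute)
        then have "chord a b < x" by (rule mult_right_less_imp_less) simp
        then show "chord (va (fun_upd \<omega> (i, ?q, k, 1) y)) (vb (fun_upd \<omega> (i, ?q, k, 1) y)) < x"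
          by (simp add: up)
      qed
      moreover have "{y. (cmod (y - c))\<^sup>2 < x} \<in> sets borel" by measurable
      ultimately show ?thesis by blast
    qed
  qed (use idx ip in \<open>simp_all | measurable\<close>)
  have "ennreal (gauss_floor^8 * x) = ennreal (gauss_floor\<^sup>2 * x) * (ennreal (gauss_floor\<^sup>2) * (ennreal (gauss_floor\<^sup>2) * ennreal (gauss_floor\<^sup>2)))"
    using x by (simp add: mult.commute mult.left_commute flip: ennreal_mult power_add)
  also have "\<dots> \<le> ennreal (gauss_floor\<^sup>2 * x) * (ennreal (gauss_floor\<^sup>2) * (ennreal (gauss_floor\<^sup>2) * emeasure (chan_space K) (?S ?C1)))"
    by (intro mult_left_mono 1) auto
  also have "\<dots> \<le> ennreal (gauss_floor\<^sup>2 * x) * (ennreal (gauss_floor\<^sup>2) * emeasure (chan_space K) (?S ?C2))"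
    by (intro mult_left_mono 2) auto
  also have "\<dots> \<le> ennreal (gauss_floor\<^sup>2 * x) * emeasure (chan_space K) (?S ?C3)"
    by (intro mult_left_mono 3) auto
  also note 4
  finally show ?thesis .
qed

end

section \<open>Moments of a coefficient and the probability of a bad reporter\<close>

definition fourth_moment :: real where "fourth_moment = enn2real (\<integral>\<^sup>+ z. ennreal ((cmod z)^4) \<partial>cgauss)"

lemma fourth_moment: "(\<integral>\<^sup>+ z. ennreal ((cmod z)^4) \<partial>cgauss) = ennreal fourth_moment" "0 \<le> fourth_moment"
  using nn_integral_cgauss_pow4_finite by (auto simp: fourth_moment_def)

text \<open>On the truncation set 1 is at most 16 |z|^2 / M, which turns the second moment into the
  fourth and gains the factor 1 / M.\<close>

lemma truncated_second_moment:
  assumes "0 \<le> c" "0 < M"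
  shows "(\<integral>\<^sup>+ z. ennreal (c * (cmod z)\<^sup>2) * indicator {z. M \<le> 16 * (cmod z)\<^sup>2} z \<partial>cgauss)
    \<le> ennreal (16 * c * fourth_moment / M)"
proof -
  have "(\<integral>\<^sup>+ z. ennreal (c * (cmod z)\<^sup>2) * indicator {z. M \<le> 16 * (cmod z)\<^sup>2} z \<partial>cgauss) \<le>
    (\<integral>\<^sup>+ z. ennreal (16 * c / M) * ennreal ((cmod z)^4) \<partial>cgauss)"
  proof (intro nn_integral_mono)
    fix z :: complex
    show "ennreal (c * (cmod z)\<^sup>2) * indicator {z. M \<le> 16 * (cmod z)\<^sup>2} z \<le> ennreal (16 * c / M) * ennreal ((cmod z)^4)"
    proof (cases "M \<le> 16 * (cmod z)\<^sup>2")
      case True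
      have "c * (cmod z)\<^sup>2 * M \<le> c * (cmod z)\<^sup>2 * (16 * (cmod z)\<^sup>2)"
        using True assms by (intro mult_left_mono) auto
      also have "\<dots> = 16 * c * (cmod z)^4" by (simp add: power4_eq_xxxx power2_eq_square)
      finally have "c * (cmod z)\<^sup>2 \<le> 16 * c / M * (cmod z)^4"
        using assms by (simp add: field_simps)
      then show ?thesis using True assms by (simp add: ennreal_leI flip: ennreal_mult)
    qed simp
  qed
  also have "\<dots> = ennreal (16 * c / M) * ennreal fourth_moment" by (simp add: nn_integral_cmult fourth_moment)
  also have "\<dots> = ennreal (16 * c * fourth_moment / M)" using assms fourth_moment(2) by (simp flip: ennreal_mult)
  finally show ?thesis .
qed

lemma second_moment:
  assumes "0 \<le> c"
  shows "(\<integral>\<^sup>+ z. ennreal (c * (cmod z)\<^sup>2) \<partial>cgauss) \<le> ennreal (c * (1 + fourth_moment))"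
proof -
  interpret C: prob_space cgauss by (rule prob_space_cgauss)
  have "(\<integral>\<^sup>+ z. ennreal (c * (cmod z)\<^sup>2) \<partial>cgauss) \<le> (\<integral>\<^sup>+ z. ennreal c * (1 + ennreal ((cmod z)^4)) \<partial>cgauss)"
  proof (intro nn_integral_mono)
    fix z :: complex
    have "0 \<le> ((cmod z)\<^sup>2 - 1)\<^sup>2 + ((cmod z)\<^sup>2)\<^sup>2 + 1" by simp
    then have "(cmod z)\<^sup>2 \<le> 1 + (cmod z)^4"
      using power_mult[of "cmod z" 2 2] by (simp add: power2_diff)
    then have "c * (cmod z)\<^sup>2 \<le> c * (1 + (cmod z)^4)" using assms by (rule mult_left_mono)
    then have "ennreal (c * (cmod z)\<^sup>2) \<le> ennreal (c * (1 + (cmod z)^4))" by (rule ennreal_leI)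
    then show "ennreal (c * (cmod z)\<^sup>2) \<le> ennreal c * (1 + ennreal ((cmod z)^4))"
      using assms by (simp add: ennreal_mult ennreal_plus)
  qed
  also have "\<dots> = ennreal c * (1 + ennreal fourth_moment)"
    using C.emeasure_space_1 by (simp add: nn_integral_cmult nn_integral_add fourth_moment)
  also have "\<dots> = ennreal (c * (1 + fourth_moment))" using assms fourth_moment(2) by (simp add: ennreal_mult ennreal_plus)
  finally show ?thesis .
qed

context cell_user
begin

text \<open>Reporting is part of the event, which is what gives its probability the factor
  \<open>x\<close>. For a reporting user the negation supplies the hypotheses of
  \<open>rate_lower\<close>.\<close>

definition bad :: "real \<Rightarrow> real \<Rightarrow> real \<Rightarrow> (nat \<times> nat \<times> nat \<times> nat \<Rightarrow> complex) \<Rightarrow> bool" where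
  "bad x \<delta> M \<omega> \<longleftrightarrow> chord (va \<omega>) (vb \<omega>) < x \<and>
     (\<not> proper \<omega> \<or> M < (vnorm (vb \<omega>))\<^sup>2 \<or> gain_gap (va \<omega>) (vb \<omega>) (vh \<omega>) < \<delta> * gap (va \<omega>) (vb \<omega>))"

lemma bad_measurable [measurable]: "Measurable.pred (chan_space K) (bad x \<delta> M)"
  unfolding bad_def by measurable

lemma emeasure_not_proper: "emeasure (chan_space K) {\<omega>\<in>space (chan_space K). \<not> proper \<omega>} = 0"
proof -
  have "emeasure (chan_space K) {\<omega>\<in>space (chan_space K). \<not> proper \<omega>} \<le>
     emeasure (chan_space K) ({\<omega>\<in>space (chan_space K). va \<omega> 0 = 0} \<union> {\<omega>\<in>space (chan_space K). vb \<omega> 0 = 0})"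
    by (intro emeasure_mono) (auto simp: proper_def)
  also have "\<dots> \<le> emeasure (chan_space K) {\<omega>\<in>space (chan_space K). va \<omega> 0 = 0} +
      emeasure (chan_space K) {\<omega>\<in>space (chan_space K). vb \<omega> 0 = 0}"
    by (rule emeasure_subadditive) measurable
  also have "\<dots> = 0"
    using interf_props[OF i] by (simp add: emeasure_coord_zero)
  finally show ?thesis by simp
qed

lemma bad_prob:
  assumes x: "0 \<le> x" "x \<le> 1/8" and "0 \<le> \<delta>" "0 < M"
  shows "emeasure (chan_space K) {\<omega>\<in>space (chan_space K). bad x \<delta> M \<omega>} \<le> ennreal (x * (4096 * (1 + fourth_moment) * (1 / M + \<delta>)))"
proof -
  let ?E = "\<lambda>Q. emeasure (chan_space K) {\<omega>\<in>space (chan_space K). Q \<omega>}"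
  let ?Q1 = "\<lambda>\<omega>. \<not> proper \<omega>"
  let ?Q2 = "\<lambda>\<omega>. chord (va \<omega>) (vb \<omega>) < x \<and> proper \<omega> \<and> (vnorm (vb \<omega>))\<^sup>2 \<ge> M"
  let ?Q3 = "\<lambda>\<omega>. chord (va \<omega>) (vb \<omega>) < x \<and> proper \<omega> \<and> gain_gap (va \<omega>) (vb \<omega>) (vh \<omega>) < \<delta> * gap (va \<omega>) (vb \<omega>)"
  have m: "0 \<le> fourth_moment" by (rule fourth_moment)
  have "?E ?Q2 \<le> 2 * ennreal (16 * (128 * x) * fourth_moment / M)"
    using chord_tail[OF x, of M] truncated_second_moment[of "128 * x" M] assms
    by (meson mult_left_mono order_trans zero_le mult_nonneg_nonneg zero_le_numeral)
  also have "\<dots> = ennreal (2 * (16 * (128 * x) * fourth_moment / M))"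
    by (subst ennreal_mult) (use assms m in auto)
  also have "\<dots> \<le> ennreal (x * (4096 * (1 + fourth_moment) * (1 / M)))"
    using assms m by (intro ennreal_leI) (simp add: field_simps)
  finally have 2: "?E ?Q2 \<le> ennreal (x * (4096 * (1 + fourth_moment) * (1 / M)))" .
  \<comment> \<open>At M = 0 the truncation is vacuous and \<open>chord_tail\<close> bounds the
    probability of reporting. The constant 4096 is 2 * 16 * 128 for the large channel and 16 * 2 *
    128 for the small gain.\<close>
  have "?E (\<lambda>\<omega>. chord (va \<omega>) (vb \<omega>) < x \<and> proper \<omega>) \<le> 2 * ennreal (128 * x * (1 + fourth_moment))"
    using chord_tail[OF x, of 0] second_moment[of "128 * x"] assms
    by (simp add: order_trans[OF _ mult_left_mono])
  also have "\<dots> = ennreal (2 * (128 * x * (1 + fourth_moment)))"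
    by (subst ennreal_mult) (use assms m in auto)
  finally have 0: "?E (\<lambda>\<omega>. chord (va \<omega>) (vb \<omega>) < x \<and> proper \<omega>) \<le> ennreal (2 * (128 * x * (1 + fourth_moment)))" .
  have "?E ?Q3 \<le> ennreal (16 * \<delta>) * ennreal (2 * (128 * x * (1 + fourth_moment)))"
    using gain_tail[of x \<delta>] x assms mult_left_mono[OF 0, of "ennreal (16 * \<delta>)"] by (force intro: order_trans)
  also have "\<dots> = ennreal (x * (4096 * (1 + fourth_moment) * \<delta>))"
    using assms m by (simp add: algebra_simps flip: ennreal_mult)
  finally have 3: "?E ?Q3 \<le> ennreal (x * (4096 * (1 + fourth_moment) * \<delta>))" .
  have "?E (bad x \<delta> M) \<le> emeasure (chan_space K) ({\<omega>\<in>space (chan_space K). ?Q1 \<omega>} \<union>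
      ({\<omega>\<in>space (chan_space K). ?Q2 \<omega>} \<union> {\<omega>\<in>space (chan_space K). ?Q3 \<omega>}))"
    by (intro emeasure_mono) (auto simp: bad_def)
  also have "\<dots> \<le> ?E ?Q1 + emeasure (chan_space K) ({\<omega>\<in>space (chan_space K). ?Q2 \<omega>} \<union> {\<omega>\<in>space (chan_space K). ?Q3 \<omega>})"
    by (rule emeasure_subadditive) measurable
  also have "\<dots> \<le> ?E ?Q1 + (?E ?Q2 + ?E ?Q3)"
    by (intro add_left_mono emeasure_subadditive) measurable
  also have "\<dots> \<le> 0 + (ennreal (x * (4096 * (1 + fourth_moment) * (1 / M))) + ennreal (x * (4096 * (1 + fourth_moment) * \<delta>)))"
    using emeasure_not_proper 2 3 by (intro add_mono) auto
  also have "\<dots> = ennreal (x * (4096 * (1 + fourth_moment) * (1 / M + \<delta>)))"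
    using assms m by (simp add: algebra_simps flip: ennreal_plus)
  finally show ?thesis .
qed

lemma rate_ge_if_not_bad:
  assumes "0 < P" "x \<le> 1" "0 \<le> \<delta>" "metric_D \<omega> i k < x" "\<not> bad x \<delta> M \<omega>"
  shows "log 2 (1 + P * \<delta> / (1 + P * (x * M))) \<le> rate P \<omega> i k"
  using assms by (intro rate_lower[OF i]) (auto simp: bad_def proper_def metric_D_eq)

end

section \<open>Independence across users and the outage probability\<close>

lemma indep_vars_coords:
  assumes "chan_idx K \<noteq> {}"
  shows "prob_space.indep_vars (chan_space K) (\<lambda>_. cgauss) (\<lambda>c \<omega>. \<omega> c) (chan_idx K)"
proof -
  interpret prob_space "chan_space K" by (rule prob_space_chan_space)
  have rv: "(\<lambda>\<omega>. \<omega> c) \<in> chan_space K \<rightarrow>\<^sub>M cgauss" if "c \<in> chan_idx K" for c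
    using measurable_coord[OF that] by (simp add: measurable_cong_sets[OF refl sets_cgauss])
  have "distr (chan_space K) (PiM (chan_idx K) (\<lambda>_. cgauss)) (\<lambda>\<omega>. \<lambda>c\<in>chan_idx K. \<omega> c) =
     distr (chan_space K) (chan_space K) (\<lambda>\<omega>. \<omega>)"
    by (intro distr_cong) (auto simp: chan_space_def space_PiM PiE_restrict)
  also have "\<dots> = chan_space K" by (simp add: distr_id2)
  also have "\<dots> = PiM (chan_idx K) (\<lambda>c. distr (chan_space K) cgauss (\<lambda>\<omega>. \<omega> c))"
    unfolding chan_space_def
    by (intro PiM_cong refl distr_PiM_component[symmetric] prob_space_cgauss)
  finally show ?thesis
    using assms rv by (subst indep_vars_iff_distr_eq_PiM') auto
qed

text \<open>The metrics of distinct users read disjoint blocks \<open>J k\<close> of coefficients,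
  so the probability that nobody reports is a product. Each factor is at most 1 - c x, hence at most
  exp (- c x), with c the constant of \<open>chord_prob_ge\<close>.\<close>

lemma outage_prob:
  assumes i: "i < 3" and K: "0 < K" and x: "0 < x" "x \<le> 1"
  shows "emeasure (chan_space K) {\<omega>\<in>space (chan_space K). \<forall>k<K. \<not> metric_D \<omega> i k < x} \<le> ennreal (exp (- (gauss_floor^8 * (K * x))))"
proof -
  interpret prob_space "chan_space K" by (rule prob_space_chan_space)
  define J :: "nat \<Rightarrow> (nat \<times> nat \<times> nat \<times> nat) set" where "J k = {i} \<times> {..<3} \<times> {k} \<times> {..<2}" for k
  have ip: "interf1 i < 3" "interf2 i < 3" using interf_props[OF i] by auto
  have user: "cell_user K i k" if "k < K" for k using i that by (simp add: cell_user_def)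
  have "(i, 0, 0, 0) \<in> chan_idx K" using K i by (simp add: chan_idx_def)
  then have ne: "chan_idx K \<noteq> {}" by blast
  have "indep_vars (\<lambda>k. PiM (J k) (\<lambda>_. cgauss)) (\<lambda>k \<omega>. restrict (\<lambda>c. \<omega> c) (J k)) {..<K}"
    using i by (intro indep_vars_restrict[OF indep_vars_coords[OF ne]])
      (auto simp: J_def chan_idx_def disjoint_family_on_def)
  then have "indep_vars (\<lambda>_. borel) (\<lambda>k \<omega>. metric_D (restrict \<omega> (J k)) i k) {..<K}"
  proof (rule indep_vars_compose2)
    fix k
    have *: "(\<lambda>\<omega>. \<omega> (i, j, k, r)) \<in> borel_measurable (PiM (J k) (\<lambda>_. cgauss))" if "j < 3" "r < 2" for j r
      using measurable_component_singleton[of "(i, j, k, r)" "J k" "\<lambda>_. cgauss"] that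
      by (simp add: J_def measurable_cong_sets[OF refl sets_cgauss])
    show "(\<lambda>\<omega>. metric_D \<omega> i k) \<in> borel_measurable (PiM (J k) (\<lambda>_. cgauss))"
      unfolding metric_D_eq by (intro borel_measurable_chord; unfold chan_def; intro * ip; simp)
  qed
  moreover have "metric_D (restrict \<omega> (J k)) i k = metric_D \<omega> i k" for \<omega> k
    using ip unfolding metric_D_eq chord_def chordal_dist_sq_def orth_basis_def vnorm_def sum_lessThan_2 chan_def
    by (simp add: J_def)
  ultimately have ind: "indep_vars (\<lambda>_. borel) (\<lambda>k \<omega>. metric_D \<omega> i k) {..<K}" by simp
  have "prob (\<Inter>k\<in>{..<K}. (\<lambda>\<omega>. metric_D \<omega> i k) -` {x..} \<inter> space (chan_space K)) =
     (\<Prod>k<K. prob ((\<lambda>\<omega>. metric_D \<omega> i k) -` {x..} \<inter> space (chan_space K)))"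
    using K by (intro indep_varsD_finite[OF ind]) auto
  also have "\<dots> \<le> (\<Prod>k<K. exp (- (gauss_floor^8 * x)))"
  proof (intro prod_mono conjI measure_nonneg)
    fix k assume "k \<in> {..<K}"
    then interpret cell_user K i k using user by simp
    let ?S = "{\<omega>\<in>space (chan_space K). chord (va \<omega>) (vb \<omega>) < x}"
    have "(\<lambda>\<omega>. metric_D \<omega> i k) -` {x..} \<inter> space (chan_space K) = space (chan_space K) - ?S"
      by (auto simp: metric_D_eq)
    then have "prob ((\<lambda>\<omega>. metric_D \<omega> i k) -` {x..} \<inter> space (chan_space K)) = 1 - prob ?S"
      by (simp add: prob_compl)
    also have "\<dots> \<le> 1 - gauss_floor^8 * x"
      using chord_prob_ge[OF x] by (simp add: emeasure_eq_measure gauss_floor_def)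
    also have "\<dots> \<le> exp (- (gauss_floor^8 * x))" using exp_ge_add_one_self[of "- (gauss_floor^8 * x)"] by simp
    finally show "prob ((\<lambda>\<omega>. metric_D \<omega> i k) -` {x..} \<inter> space (chan_space K)) \<le> exp (- (gauss_floor^8 * x))" .
  qed
  also have "\<dots> = exp (- (gauss_floor^8 * (K * x)))" by (simp add: algebra_simps flip: exp_of_nat_mult)
  also have "(\<Inter>k\<in>{..<K}. (\<lambda>\<omega>. metric_D \<omega> i k) -` {x..} \<inter> space (chan_space K)) =
     {\<omega>\<in>space (chan_space K). \<forall>k<K. \<not> metric_D \<omega> i k < x}"
    using K by (auto simp: not_less)
  finally show ?thesis by (simp add: emeasure_eq_measure)
qed

section \<open>The expected rate of the selected user\<close>

lemma reporters_finite: "finite (reporters K x \<omega> i)"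
  by (simp add: reporters_def)

lemma selected_rate_le:
  assumes "i < 3" "0 \<le> P"
  shows "selected_rate K x P \<omega> i \<le> (\<Sum>k<K. rate P \<omega> i k)"
proof -
  have le: "a / real n \<le> a" if "0 \<le> a" for a n
    using that by (cases "n = 0") (auto simp: divide_le_eq mult_le_cancel_left1)
  have "(\<Sum>k\<in>reporters K x \<omega> i. rate P \<omega> i k) \<le> (\<Sum>k<K. rate P \<omega> i k)"
    using assms by (intro sum_mono2) (auto simp: reporters_def rate_nonneg)
  then show ?thesis
    using assms le sum_nonneg rate_nonneg unfolding selected_rate_def
    by (smt (verit, best))
qed

text \<open>\<open>enn2real\<close> maps infinity to 0, so this finiteness is what lets a lower
  bound on the integral pass to \<open>expected_rate\<close>. The selected rate is dominated by the
  sum of all rates, each controlled by second moments.\<close>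

lemma selected_rate_integral_finite:
  assumes i: "i < 3" and P: "0 \<le> P"
  shows "(\<integral>\<^sup>+ \<omega>. ennreal (selected_rate K x P \<omega> i) \<partial>chan_space K) < \<infinity>"
proof -
  define c where "c = P / ln 2"
  have c: "0 \<le> c" using P by (simp add: c_def)
  have "(\<integral>\<^sup>+ \<omega>. ennreal (selected_rate K x P \<omega> i) \<partial>chan_space K) \<le>
    (\<integral>\<^sup>+ \<omega>. (\<Sum>k<K. \<Sum>r<2. ennreal (c * (cmod (\<omega> (i, i, k, r)))\<^sup>2)) \<partial>chan_space K)"
  proof (intro nn_integral_mono)
    fix \<omega>
    have "selected_rate K x P \<omega> i \<le> (\<Sum>k<K. rate P \<omega> i k)" by (rule selected_rate_le[OF i P])
    also have "\<dots> \<le> (\<Sum>k<K. \<Sum>r<2. c * (cmod (\<omega> (i, i, k, r)))\<^sup>2)"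
    proof (intro sum_mono)
      fix k show "rate P \<omega> i k \<le> (\<Sum>r<2. c * (cmod (\<omega> (i, i, k, r)))\<^sup>2)"
        using rate_upper[OF i P, of \<omega> k] by (simp add: c_def vnorm_sq chan_def sum_lessThan_2 distrib_left add_divide_distrib)
    qed
    finally have "ennreal (selected_rate K x P \<omega> i) \<le> ennreal (\<Sum>k<K. \<Sum>r<2. c * (cmod (\<omega> (i, i, k, r)))\<^sup>2)"
      by (rule ennreal_leI)
    then show "ennreal (selected_rate K x P \<omega> i) \<le> (\<Sum>k<K. \<Sum>r<2. ennreal (c * (cmod (\<omega> (i, i, k, r)))\<^sup>2))"
      using c by (simp add: sum_ennreal sum_nonneg)
  qed
  also have "\<dots> = (\<Sum>k<K. \<Sum>r<2. \<integral>\<^sup>+ \<omega>. ennreal (c * (cmod (\<omega> (i, i, k, r)))\<^sup>2) \<partial>chan_space K)"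
  proof -
    have [measurable]: "(\<lambda>\<omega>. ennreal (c * (cmod (\<omega> (i, i, k, r)))\<^sup>2)) \<in> borel_measurable (chan_space K)"
      if "k \<in> {..<K}" "r \<in> {..<2}" for k r
    proof -
      have [measurable]: "(\<lambda>\<omega>. \<omega> (i, i, k, r)) \<in> borel_measurable (chan_space K)"
        using that i by (intro measurable_coord) (simp add: chan_idx_def)
      show ?thesis by measurable
    qed
    show ?thesis by (simp add: nn_integral_sum)
  qed
  also have "\<dots> \<le> (\<Sum>k<K. \<Sum>r<2::nat. ennreal (c * (1 + fourth_moment)))"
  proof (intro sum_mono)
    fix k r assume kr: "k \<in> {..<K}" "r \<in> {..<2::nat}"
    have "(\<integral>\<^sup>+ \<omega>. ennreal (c * (cmod (\<omega> (i, i, k, r)))\<^sup>2) \<partial>chan_space K) = (\<integral>\<^sup>+ z. ennreal (c * (cmod z)\<^sup>2) \<partial>cgauss)"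
      using kr i by (intro nn_integral_coord) (auto simp: chan_idx_def)
    also have "\<dots> \<le> ennreal (c * (1 + fourth_moment))" by (rule second_moment[OF c])
    finally show "(\<integral>\<^sup>+ \<omega>. ennreal (c * (cmod (\<omega> (i, i, k, r)))\<^sup>2) \<partial>chan_space K) \<le> ennreal (c * (1 + fourth_moment))" .
  qed
  also have "\<dots> < \<infinity>" by (simp add: ennreal_mult_less_top of_nat_less_top)
  finally show ?thesis .
qed

lemma expected_rate_ge:
  assumes i: "i < 3" and K: "0 < K" and P: "0 < P" and x: "0 < x" "x \<le> 1/8" and d: "0 \<le> \<delta>" and M: "0 < M"
  defines "L \<equiv> log 2 (1 + P * \<delta> / (1 + P * (x * M)))"
  shows "L * (1 - exp (- (gauss_floor^8 * (K * x))) - K * x * (4096 * (1 + fourth_moment) * (1 / M + \<delta>))) \<le> expected_rate K x P i"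
proof -
  interpret prob_space "chan_space K" by (rule prob_space_chan_space)
  have user: "cell_user K i k" if "k < K" for k using i that by (simp add: cell_user_def)
  define \<eta> where "\<eta> = x * (4096 * (1 + fourth_moment) * (1 / M + \<delta>))"
  have eta: "0 \<le> \<eta>" using x d M fourth_moment(2) by (simp add: \<eta>_def)
  define B where "B k = {\<omega>\<in>space (chan_space K). cell_user.bad i k x \<delta> M \<omega>}" for k
  define N where "N = {\<omega>\<in>space (chan_space K). \<forall>k<K. \<not> metric_D \<omega> i k < x}"
  define G where "G = space (chan_space K) - (N \<union> (\<Union>k<K. B k))"
  have Bm[measurable]: "B k \<in> sets (chan_space K)" if "k < K" for k
  proof -
    interpret cell_user K i k by (rule user[OF that])
    show ?thesis unfolding B_def by measurable
  qed
  have Nm[measurable]: "N \<in> sets (chan_space K)"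
  proof -
    have "{\<omega>\<in>space (chan_space K). \<not> metric_D \<omega> i k < x} \<in> sets (chan_space K)" if "k < K" for k
    proof -
      interpret cell_user K i k by (rule user[OF that])
      show ?thesis unfolding metric_D_eq by measurable
    qed
    moreover have "N = (\<Inter>k\<in>{..<K}. {\<omega>\<in>space (chan_space K). \<not> metric_D \<omega> i k < x})"
      using K by (auto simp: N_def)
    ultimately show ?thesis using K by (auto intro!: sets.finite_INT)
  qed
  have UB[measurable]: "(\<Union>k<K. B k) \<in> sets (chan_space K)" using Bm by auto
  have Gm[measurable]: "G \<in> sets (chan_space K)" unfolding G_def by measurable
  have pN: "prob N \<le> exp (- (gauss_floor^8 * (K * x)))"
    using outage_prob[OF i K x(1)] x by (simp add: N_def emeasure_eq_measure)
  have "prob (\<Union>k<K. B k) \<le> (\<Sum>k<K. prob (B k))"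
    using Bm by (intro finite_measure_subadditive_finite) auto
  also have "\<dots> \<le> (\<Sum>k<K. \<eta>)"
  proof (intro sum_mono)
    fix k assume "k \<in> {..<K}"
    then interpret cell_user K i k using user by simp
    show "prob (B k) \<le> \<eta>"
      using bad_prob[OF less_imp_le[OF x(1)] x(2) d M] eta by (simp add: B_def \<eta>_def emeasure_eq_measure)
  qed
  finally have pB: "prob (\<Union>k<K. B k) \<le> K * \<eta>" by simp
  have "prob (N \<union> (\<Union>k<K. B k)) \<le> prob N + prob (\<Union>k<K. B k)"
    by (rule measure_Un_le) measurable
  moreover have "prob G = 1 - prob (N \<union> (\<Union>k<K. B k))"
    unfolding G_def by (rule prob_compl) measurable
  ultimately have pG: "1 - exp (- (gauss_floor^8 * (K * x))) - K * \<eta> \<le> prob G" using pN pB by linarith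
  have L: "0 \<le> L" using P x d M by (simp add: L_def add_pos_nonneg)
  have "ennreal (L * prob G) = (\<integral>\<^sup>+ \<omega>. ennreal L * indicator G \<omega> \<partial>chan_space K)"
    using L by (simp add: nn_integral_cmult_indicator emeasure_eq_measure ennreal_mult)
  \<comment> \<open>Only monotonicity of the integral is used, so the comparison rests on the
    measurability of \<open>G\<close> and not on that of the rate. On \<open>G\<close> the selected
    rate is a mean over a nonempty set of rates that are all at least \<open>L\<close>.\<close>
  also have "\<dots> \<le> (\<integral>\<^sup>+ \<omega>. ennreal (selected_rate K x P \<omega> i) \<partial>chan_space K)"
  proof (intro nn_integral_mono)
    fix \<omega> assume w: "\<omega> \<in> space (chan_space K)"
    show "ennreal L * indicator G \<omega> \<le> ennreal (selected_rate K x P \<omega> i)"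
    proof (cases "\<omega> \<in> G")
      case True
      let ?R = "reporters K x \<omega> i"
      have ne: "?R \<noteq> {}" using True w by (auto simp: G_def N_def reporters_def)
      have "(\<Sum>k\<in>?R. L) \<le> (\<Sum>k\<in>?R. rate P \<omega> i k)"
      proof (intro sum_mono)
        fix k assume kR: "k \<in> ?R"
        then interpret cell_user K i k using user by (simp add: reporters_def)
        show "L \<le> rate P \<omega> i k"
          unfolding L_def using True w kR x
          by (intro rate_ge_if_not_bad P d) (auto simp: G_def B_def reporters_def)
      qed
      moreover have "card ?R > 0" using ne reporters_finite by (simp add: card_gt_0_iff)
      ultimately have "L \<le> selected_rate K x P \<omega> i"
        using ne by (simp add: selected_rate_def le_divide_eq mult.commute)
      then show ?thesis using True by (simp add: ennreal_leI)
    qed simp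
  qed
  finally have "enn2real (ennreal (L * prob G)) \<le> expected_rate K x P i"
    unfolding expected_rate_def using selected_rate_integral_finite[OF i, of P K x] P by (intro enn2real_mono) auto
  then have "L * prob G \<le> expected_rate K x P i" using L by simp
  moreover have "L * (1 - exp (- (gauss_floor^8 * (K * x))) - K * \<eta>) \<le> L * prob G"
    by (rule mult_left_mono[OF pG L])
  ultimately show ?thesis by (simp add: \<eta>_def mult.assoc)
qed

text \<open>The threshold is 1 - exp (- y) with y = ln K / (K - 1) in (0, 1], hence between y / 2
  and y. The upper bound also uses that K - 1 is at least K / 2.\<close>

lemma threshold_bounds:
  assumes "2 \<le> K"
  shows "0 < threshold K" "threshold K \<le> 2 * ln K / K" "ln K / 2 \<le> K * threshold K"
proof -
  define y where "y = ln K / (real K - 1)"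
  have K: "real K \<ge> 2" using assms by simp
  have y: "0 < y" "y \<le> 1" using K ln_le_minus_one[of "real K"] by (auto simp: y_def divide_le_eq)
  have t: "threshold K = 1 - exp (- y)"
    using K by (simp add: threshold_def powr_def ln_div y_def)
  show "0 < threshold K" using y by (simp add: t)
  have "threshold K \<le> y" using exp_ge_add_one_self[of "- y"] by (simp add: t)
  also have "\<dots> \<le> 2 * ln K / K" using K by (simp add: y_def field_simps)
  finally show "threshold K \<le> 2 * ln K / K" .
  have "exp (- y) \<le> 1 / (1 + y)" using exp_ge_add_one_self[of y] y by (simp add: exp_minus field_simps)
  also have "\<dots> \<le> 1 - y / 2" using y by (simp add: field_simps)
  finally have "y / 2 \<le> threshold K" by (simp add: t)
  then have "K * (y / 2) \<le> K * threshold K" using K by (intro mult_left_mono) auto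
  moreover have "ln K / 2 \<le> K * (y / 2)" using K by (simp add: y_def field_simps)
  ultimately show "ln K / 2 \<le> K * threshold K" by linarith
qed

section \<open>Degrees of freedom\<close>

text \<open>The interference P x l^2 is at most P^(1 - d) times 8 l^3 / \<kappa>, and
  \<open>d \<le> 1\<close> lets P^(1 - d) absorb the noise power 1 as well. The ratio is then at
  least P^d over a polylogarithmic factor.\<close>

lemma log_rate_bound:
  fixes P \<kappa> d x l :: real
  assumes "exp 1 < P" "0 < \<kappa>" "d \<le> 1" "0 \<le> x" and x: "x \<le> 8 * ln P / (\<kappa> * P powr d)"
  shows "(d - ln ((ln P)\<^sup>2 * (1 + 8 * ln P ^ 3 / \<kappa>)) / ln P) * ln P / ln 2 \<le>
    log 2 (1 + P * (1 / (ln P)\<^sup>2) / (1 + P * (x * (ln P)\<^sup>2)))"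
proof -
  have P: "1 < P" using assms(1) exp_gt_one[of 1] by linarith
  have l: "0 < ln P" using P by simp
  define D where "D = 1 + 8 * ln P ^ 3 / \<kappa>"
  have D: "1 \<le> D" using l assms by (simp add: D_def)
  have pp: "P = P powr (1 - d) * P powr d" using P by (simp flip: powr_add)
  have "P * (x * (ln P)\<^sup>2) \<le> P * (8 * ln P / (\<kappa> * P powr d) * (ln P)\<^sup>2)"
    using x P by (intro mult_left_mono mult_right_mono) auto
  also have "\<dots> = P powr (1 - d) * (8 * ln P ^ 3 / \<kappa>)"
    using P assms(2) by (subst pp) (simp add: field_simps power3_eq_cube power2_eq_square)
  finally have 1: "1 + P * (x * (ln P)\<^sup>2) \<le> P powr (1 - d) * D"
    using ge_one_powr_ge_zero[of P "1 - d"] P assms(3) by (simp add: D_def distrib_left)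
  have pos: "0 < 1 + P * (x * (ln P)\<^sup>2)" using P assms(4) by (simp add: add_pos_nonneg)
  have "P powr d / ((ln P)\<^sup>2 * D) = P * (1 / (ln P)\<^sup>2) / (P powr (1 - d) * D)"
    using P D l by (subst pp) (simp add: field_simps)
  also have "\<dots> \<le> P * (1 / (ln P)\<^sup>2) / (1 + P * (x * (ln P)\<^sup>2))"
    using 1 pos P by (intro divide_left_mono) auto
  finally have "ln (P powr d / ((ln P)\<^sup>2 * D)) \<le> ln (1 + P * (1 / (ln P)\<^sup>2) / (1 + P * (x * (ln P)\<^sup>2)))"
    using P D l pos
    by (subst ln_le_cancel_iff) (auto intro!: divide_pos_pos mult_pos_pos add_pos_nonneg divide_nonneg_nonneg)
  moreover have "ln (P powr d / ((ln P)\<^sup>2 * D)) = d * ln P - ln ((ln P)\<^sup>2 * D)"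
    using P D l by (subst ln_div) (auto simp: ln_powr)
  ultimately have "d * ln P - ln ((ln P)\<^sup>2 * D) \<le> ln (1 + P * (1 / (ln P)\<^sup>2) / (1 + P * (x * (ln P)\<^sup>2)))" by simp
  then have "(d * ln P - ln ((ln P)\<^sup>2 * D)) / ln 2 \<le> log 2 (1 + P * (1 / (ln P)\<^sup>2) / (1 + P * (x * (ln P)\<^sup>2)))"
    unfolding log_def by (rule divide_right_mono) simp
  then show ?thesis using l by (simp add: D_def left_diff_distrib)
qed

theorem theorem1:
  fixes d' \<kappa> :: real and K :: "real \<Rightarrow> nat" and i :: nat
  assumes "0 \<le> d'" and "d' \<le> 1"
    and "\<forall>P. K P \<ge> 2"
    and "0 < \<kappa>"
    and "((\<lambda>P. real (K P) / P powr d') \<longlongrightarrow> \<kappa>) at_top"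
    and "i < 3"
  shows "Liminf at_top
           (\<lambda>P. ereal (expected_rate (K P) (threshold (K P)) P i / log 2 P)) \<ge> ereal d'"
proof (cases "d' = 0")
  case True
  have "eventually (\<lambda>P. ereal d' \<le> ereal (expected_rate (K P) (threshold (K P)) P i / log 2 P)) at_top"
    using eventually_gt_at_top[of 1] by eventually_elim (simp add: True expected_rate_def)
  then show ?thesis by (rule Liminf_bounded)
next
  case False
  then have d: "0 < d'" using assms by simp
  define c where "c = gauss_floor^8"
  have c: "0 < c" by (simp add: c_def gauss_floor_def)
  define C where "C = 4096 * (1 + fourth_moment)"
  have C: "0 < C" using fourth_moment(2) by (simp add: C_def)
  \<comment> \<open>\<open>A\<close> bounds the normalised rate of a good reporter and
    \<open>B\<close> the probability that all goes well. In \<open>B\<close>, the exponent uses K x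
    \<ge> ln K / 2 with K \<ge> \<kappa> / 2 * P^d'; the last term is K x \<le> 4 ln P times C (1 /
    M + \<delta>) with M = (ln P)^2 and \<delta> = 1 / M.\<close>
  define A where "A P = d' - ln ((ln P)\<^sup>2 * (1 + 8 * ln P ^ 3 / \<kappa>)) / ln P" for P :: real
  define B where "B P = 1 - exp (- (c * (ln (\<kappa> / 2 * P powr d') / 2))) - 8 * C / ln P" for P :: real
  have k: "0 < \<kappa>" by fact
  have A: "(A \<longlongrightarrow> d') at_top" unfolding A_def using k by real_asymp
  have B: "(B \<longlongrightarrow> 1) at_top" unfolding B_def using k c C d by real_asymp
  have "eventually (\<lambda>P. B P > 0) at_top" using order_tendstoD(1)[OF B, of 0] by simp
  moreover have "eventually (\<lambda>P. A P > 0) at_top" using order_tendstoD(1)[OF A d] .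
  moreover have "eventually (\<lambda>P. \<kappa> / 2 < real (K P) / P powr d') at_top"
    using order_tendstoD(1)[OF assms(5), of "\<kappa> / 2"] k by simp
  moreover have "eventually (\<lambda>P. real (K P) / P powr d' < 2 * \<kappa>) at_top"
    using order_tendstoD(2)[OF assms(5), of "2 * \<kappa>"] k by simp
  moreover have "eventually (\<lambda>P. ln (2 * \<kappa> * P powr d') \<le> 2 * ln P) at_top"
    using k d assms(2) by (cases "d' = 1") real_asymp+
  moreover have "eventually (\<lambda>P. 8 * ln P / (\<kappa> * P powr d') \<le> 1 / 8) at_top"
    using k d by real_asymp
  ultimately have "eventually (\<lambda>P. ereal (A P * B P) \<le> ereal (expected_rate (K P) (threshold (K P)) P i / log 2 P)) at_top"
    using eventually_gt_at_top[of "exp 1"] eventually_gt_at_top[of 1]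
  proof eventually_elim
    case (elim P)
    define x where "x = threshold (K P)"
    define L where "L = log 2 (1 + P * (1 / (ln P)\<^sup>2) / (1 + P * (x * (ln P)\<^sup>2)))"
    have l: "0 < ln P" using elim by simp
    have K2: "2 \<le> K P" using assms(3) by simp
    have Pd: "0 < P powr d'" using elim by simp
    have Klo: "\<kappa> / 2 * P powr d' < K P" and Khi: "K P < 2 * \<kappa> * P powr d'"
      using elim(3,4) Pd by (simp_all add: field_simps)
    have lnK: "ln (K P) \<le> 2 * ln P"
    proof -
      have "ln (K P) \<le> ln (2 * \<kappa> * P powr d')" using Khi K2 by (subst ln_le_cancel_iff) auto
      then show ?thesis using elim(5) by linarith
    qed
    note t = threshold_bounds[OF K2, folded x_def]
    have "x \<le> 4 * ln P / K P"
      using t(2) lnK K2 by (elim order_trans) (simp add: divide_right_mono)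
    also have "\<dots> \<le> 4 * ln P / (\<kappa> / 2 * P powr d')"
      using Klo l k Pd K2 by (intro divide_left_mono) auto
    also have "\<dots> = 8 * ln P / (\<kappa> * P powr d')" by simp
    finally have x: "x \<le> 8 * ln P / (\<kappa> * P powr d')" .
    have x8: "x \<le> 1/8" using x elim(6) by linarith
    have Kx: "K P * x \<le> 4 * ln P"
    proof -
      have "K P * x \<le> K P * (2 * ln (K P) / K P)" using t(2) by (intro mult_left_mono) auto
      then show ?thesis using K2 lnK by simp
    qed
    have w: "B P \<le> 1 - exp (- (c * (K P * x))) - K P * x * (C * (1 / (ln P)\<^sup>2 + 1 / (ln P)\<^sup>2))"
    proof -
      have "ln (\<kappa> / 2 * P powr d') \<le> ln (K P)" using Klo k Pd K2 by (subst ln_le_cancel_iff) auto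
      then have "ln (\<kappa> / 2 * P powr d') / 2 \<le> K P * x" using t(3) by linarith
      then have "exp (- (c * (K P * x))) \<le> exp (- (c * (ln (\<kappa> / 2 * P powr d') / 2)))"
        using c by (simp del: ln_mult)
      moreover have "K P * x * (C * (1 / (ln P)\<^sup>2 + 1 / (ln P)\<^sup>2)) \<le> 4 * ln P * (C * (1 / (ln P)\<^sup>2 + 1 / (ln P)\<^sup>2))"
        using Kx C by (intro mult_right_mono) auto
      moreover have "4 * ln P * (C * (1 / (ln P)\<^sup>2 + 1 / (ln P)\<^sup>2)) = 8 * C / ln P"
        using l by (simp add: field_simps power2_eq_square)
      ultimately show ?thesis unfolding B_def by linarith
    qed
    have AL: "A P * ln P / ln 2 \<le> L"
      unfolding A_def L_def using elim k t(1) x assms(2) by (intro log_rate_bound) auto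
    moreover have "0 \<le> A P * ln P / ln 2" using elim(2) l by simp
    ultimately have "0 \<le> L" by linarith
    \<comment> \<open>Multiplying the two lower bounds needs signs: \<open>B P\<close> is positive
      here, and \<open>L\<close> is nonnegative in the next line, because only large P are
      considered.\<close>
    have "A P * log 2 P * B P \<le> L * B P"
      using AL elim(1) by (intro mult_right_mono) (auto simp: log_def)
    also have "\<dots> \<le> L * (1 - exp (- (c * (K P * x))) - K P * x * (C * (1 / (ln P)\<^sup>2 + 1 / (ln P)\<^sup>2)))"
      by (rule mult_left_mono[OF w \<open>0 \<le> L\<close>])
    also have "\<dots> \<le> expected_rate (K P) x P i"
      unfolding L_def c_def C_def using elim K2 t(1) x8 l
      by (intro expected_rate_ge[OF assms(6)]) auto
    finally have "A P * B P * log 2 P \<le> expected_rate (K P) x P i" by (simp add: mult_ac)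
    then show ?case using elim(8) by (simp add: x_def le_divide_eq)
  qed
  then have "Liminf at_top (\<lambda>P. ereal (A P * B P)) \<le>
      Liminf at_top (\<lambda>P. ereal (expected_rate (K P) (threshold (K P)) P i / log 2 P))"
    by (rule Liminf_mono)
  moreover have "((\<lambda>P. ereal (A P * B P)) \<longlongrightarrow> ereal d') at_top"
    using tendsto_mult[OF A B] by (intro tendsto_ereal) simp
  then have "Liminf at_top (\<lambda>P. ereal (A P * B P)) = ereal d'"
    by (intro lim_imp_Liminf) simp_all
  ultimately show ?thesis by simp
qed

end
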